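(* For any $s\in(2,5/2]$ there exist $(\theta,\phi,\omega)\in\mathbb{R}^3$ and a quantum behaviour $p(ab|xy)$ whose four correlators are $$\langle A_0B_0\rangle=\sin\phi,\quad \langle A_0B_1\rangle=\sin\omega,\quad \langle A_1B_0\rangle=\sin(\theta+\phi),\quad \langle A_1B_1\rangle=\sin(\theta+\omega),$$ such that $r^{\mathrm{key}}_{\theta,\phi,\omega}=1$ and $I_{\mathrm{CHSH}}=s$.
   Context: Scenario: Alice and Bob have inputs $x,y\in\{0,1\}$ and outputs $a,b\in\{0,1\}$. A quantum strategy consists of a state $\rho_{\tilde Q_A\tilde Q_B}$ on $\mathcal H_{\tilde Q_A}\otimes\mathcal H_{\tilde Q_B}$ and projective measurements $\{\tilde M_{a|x}\}_a$ on $\mathcal H_{\tilde Q_A}$, $\{\tilde N_{b|y}\}_b$ on $\mathcal H_{\tilde Q_B}$. It generates the quantum behaviour $p(ab|xy)=\mathrm{Tr}[(\tilde M_{a|x}\otimes\tilde N_{b|y})\rho_{\tilde Q_A\tilde Q_B}]$. Correlators: $\langle A_xB_y\rangle=\sum_{ab}(-1)^{a+b}p(ab|xy)$. CHSH value: $I_{\mathrm{CHSH}}=\langle A_0B_0\rangle+\langle A_0B_1\rangle+\langle A_1B_0\rangle-\langle A_1B_1\rangle$. The correlator values in the claim are those generated by the two-qubit strategy with state $|\psi\rangle=(|00\rangle+i|11\rangle)/\sqrt2$ and observables $A_0=\sigma_X$, $A_1=\cos\theta\,\sigma_X+\sin\theta\,\sigma_Y$, $B_0=\cos\phi\,\sigma_X+\sin\phi\,\sigma_Y$,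 $B_1=\cos\omega\,\sigma_X+\sin\omega\,\sigma_Y$. Adversary and entropies: Eve holds a purification $|\Psi\rangle_{\tilde Q_A\tilde Q_BE}$ of $\rho_{\tilde Q_A\tilde Q_B}$. For input $x$, $\rho_{AE|X=x}=\sum_a|a\rangle\langle a|_A\otimes\mathrm{Tr}_{\tilde Q_A\tilde Q_B}[(\tilde M_{a|x}\otimes\mathbb I)|\Psi\rangle\langle\Psi|]$, and $H(A|X=x,E)$ is its conditional von Neumann entropy (in bits). $H(A|X=x,Y=y,B)$ is the conditional Shannon entropy (in bits) of $a$ given $b$ under $p(\cdot\,\cdot|xy)$. Key rate with all four correlators constrained: $$r^{\mathrm{key}}_{\theta,\phi,\omega}=\max_{x,y}\Big(\inf H(A|X=x,E)-H(A|X=x,Y=y,B)\Big),$$ where the infimum is over all quantum strategies and purifications whose four correlators equal the values in the claim, and the second term is evaluated on the behaviour $p$. *)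

theory Defs
  imports "HOL-Analysis.Analysis"
begin

text \<open>
  A separable Hilbert space, of finite or infinite dimension, is represented by a set \<open>I\<close> of
  labels of an orthonormal basis, i.e. as \<open>\<ell>\<^sup>2(I)\<close>. An operator is represented by its matrix
  elements \<open>T i j\<close> for \<open>i, j \<in> I\<close>; entries outside \<open>I\<close> are irrelevant. The tensor product of the
  spaces over \<open>I\<close> and \<open>J\<close> is the space over \<open>I \<times> J\<close>. Every infinite sum below converges absolutely
  for the projections, density operators and state vectors it is applied to.
\<close>

type_synonym 'i operator = "'i \<Rightarrow> 'i \<Rightarrow> complex"

definition id_op :: "'i operator" where
  "id_op i j = (if i = j then 1 else 0)"

definition op_mult :: "'i set \<Rightarrow> 'i operator \<Rightarrow> 'i operator \<Rightarrow> 'i operator" where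
  "op_mult I S T i j = (\<Sum>\<^sub>\<infinity>k\<in>I. S i k * T k j)"

definition op_trace :: "'i set \<Rightarrow> 'i operator \<Rightarrow> complex" where
  "op_trace I T = (\<Sum>\<^sub>\<infinity>i\<in>I. T i i)"

definition tensor :: "'i operator \<Rightarrow> 'j operator \<Rightarrow> ('i \<times> 'j) operator" where
  "tensor S T p q = S (fst p) (fst q) * T (snd p) (snd q)"

definition ket :: "'i \<Rightarrow> 'i \<Rightarrow> complex" where
  "ket i k = (if k = i then 1 else 0)"

definition ketbra :: "('i \<Rightarrow> complex) \<Rightarrow> 'i operator" where
  "ketbra \<psi> i j = \<psi> i * cnj (\<psi> j)"

definition trace_out_fst :: "'i set \<Rightarrow> ('i \<times> 'j) operator \<Rightarrow> 'j operator" where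
  "trace_out_fst I T j l = (\<Sum>\<^sub>\<infinity>i\<in>I. T (i, j) (i, l))"

definition trace_out_snd :: "'j set \<Rightarrow> ('i \<times> 'j) operator \<Rightarrow> 'i operator" where
  "trace_out_snd J T i k = (\<Sum>\<^sub>\<infinity>j\<in>J. T (i, j) (k, j))"

text \<open>
  Hermitian and idempotent. The diagonal of the second condition makes every row square-summable,
  and then \<open>\<parallel>P v\<parallel>\<^sup>2 = \<langle>v, P v\<rangle>\<close> for finitely supported \<open>v\<close>, so boundedness is automatic.
\<close>

definition projection :: "'i set \<Rightarrow> 'i operator \<Rightarrow> bool" where
  "projection I P \<longleftrightarrow>
     (\<forall>i\<in>I. \<forall>j\<in>I. P j i = cnj (P i j)) \<and>
     (\<forall>i\<in>I. \<forall>j\<in>I. ((\<lambda>k. P i k * P k j) has_sum P i j) I)"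

text \<open>
  Positivity is tested on finitely supported vectors; a positive matrix with summable diagonal is
  the matrix of a positive trace-class operator.
\<close>

definition density_operator :: "'i set \<Rightarrow> 'i operator \<Rightarrow> bool" where
  "density_operator I \<rho> \<longleftrightarrow>
     (\<forall>F v. finite F \<and> F \<subseteq> I \<longrightarrow> (\<Sum>i\<in>F. \<Sum>j\<in>F. cnj (v i) * \<rho> i j * v j) \<in> \<real>\<^sub>\<ge>\<^sub>0) \<and>
     ((\<lambda>i. \<rho> i i) has_sum 1) I"

text \<open>Binary inputs and outputs are the natural numbers 0 and 1.\<close>

definition projective_measurement :: "'i set \<Rightarrow> (nat \<Rightarrow> 'i operator) \<Rightarrow> bool" where
  "projective_measurement I M \<longleftrightarrow>
     (\<forall>a\<in>{0, 1}. projection I (M a)) \<and>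
     (\<forall>i\<in>I. \<forall>j\<in>I. (\<Sum>a\<in>{0, 1}. M a i j) = id_op i j)"

text \<open>\<open>M a x\<close> is the element for outcome \<open>a\<close> of Alice's measurement \<open>x\<close>; similarly \<open>N b y\<close>.\<close>

definition quantum_strategy ::
  "'i set \<Rightarrow> 'j set \<Rightarrow> ('i \<times> 'j) operator \<Rightarrow> (nat \<Rightarrow> nat \<Rightarrow> 'i operator) \<Rightarrow>
   (nat \<Rightarrow> nat \<Rightarrow> 'j operator) \<Rightarrow> bool" where
  "quantum_strategy IA IB \<rho> M N \<longleftrightarrow>
     density_operator (IA \<times> IB) \<rho> \<and>
     (\<forall>x\<in>{0, 1}. projective_measurement IA (\<lambda>a. M a x)) \<and>
     (\<forall>y\<in>{0, 1}. projective_measurement IB (\<lambda>b. N b y))"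

text \<open>
  A behaviour \<open>p a b x y\<close> is \<open>p(ab|xy)\<close>. The trace below is real for every quantum strategy;
  \<open>Re\<close> only changes the type.
\<close>

type_synonym behaviour = "nat \<Rightarrow> nat \<Rightarrow> nat \<Rightarrow> nat \<Rightarrow> real"

definition generated_behaviour ::
  "'i set \<Rightarrow> 'j set \<Rightarrow> ('i \<times> 'j) operator \<Rightarrow> (nat \<Rightarrow> nat \<Rightarrow> 'i operator) \<Rightarrow>
   (nat \<Rightarrow> nat \<Rightarrow> 'j operator) \<Rightarrow> behaviour" where
  "generated_behaviour IA IB \<rho> M N a b x y =
     Re (op_trace (IA \<times> IB) (op_mult (IA \<times> IB) (tensor (M a x) (N b y)) \<rho>))"

definition quantum_behaviour :: "behaviour \<Rightarrow> bool" where
  "quantum_behaviour p \<longleftrightarrow>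
     (\<exists>(IA :: nat set) (IB :: nat set) \<rho> M N. quantum_strategy IA IB \<rho> M N \<and>
        (\<forall>a\<in>{0, 1}. \<forall>b\<in>{0, 1}. \<forall>x\<in>{0, 1}. \<forall>y\<in>{0, 1}.
           p a b x y = generated_behaviour IA IB \<rho> M N a b x y))"

definition correlator :: "behaviour \<Rightarrow> nat \<Rightarrow> nat \<Rightarrow> real" where
  "correlator p x y = (\<Sum>a\<in>{0, 1}. \<Sum>b\<in>{0, 1}. (-1) ^ (a + b) * p a b x y)"

definition CHSH :: "behaviour \<Rightarrow> real" where
  "CHSH p = correlator p 0 0 + correlator p 0 1 + correlator p 1 0 - correlator p 1 1"

definition has_target_correlators :: "real \<Rightarrow> real \<Rightarrow> real \<Rightarrow> behaviour \<Rightarrow> bool" where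
  "has_target_correlators \<theta> \<phi> \<omega> p \<longleftrightarrow>
     correlator p 0 0 = sin \<phi> \<and> correlator p 0 1 = sin \<omega> \<and>
     correlator p 1 0 = sin (\<theta> + \<phi>) \<and> correlator p 1 1 = sin (\<theta> + \<omega>)"

definition purification ::
  "'q set \<Rightarrow> 'e set \<Rightarrow> ('q \<times> 'e \<Rightarrow> complex) \<Rightarrow> 'q operator \<Rightarrow> bool" where
  "purification Q E \<Psi> \<rho> \<longleftrightarrow>
     ((\<lambda>i. (cmod (\<Psi> i))\<^sup>2) has_sum 1) (Q \<times> E) \<and>
     (\<forall>q\<in>Q. \<forall>q'\<in>Q. trace_out_snd E (ketbra \<Psi>) q q' = \<rho> q q')"

text \<open>
  The classical-quantum state of Alice's outcome and Eve, on the space over \<open>{0, 1} \<times> E\<close>, when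
  Alice measures \<open>\<lambda>a. M a\<close>.
\<close>

definition cq_state ::
  "'i set \<Rightarrow> 'j set \<Rightarrow> 'e set \<Rightarrow> (nat \<Rightarrow> 'i operator) \<Rightarrow> (('i \<times> 'j) \<times> 'e \<Rightarrow> complex) \<Rightarrow>
   (nat \<times> 'e) operator" where
  "cq_state IA IB E M \<Psi> p q =
     (\<Sum>a\<in>{0, 1}. tensor (ketbra (ket a))
        (trace_out_fst (IA \<times> IB)
           (op_mult ((IA \<times> IB) \<times> E) (tensor (tensor (M a) id_op) id_op) (ketbra \<Psi>))) p q)"

definition unitary_op :: "'i set \<Rightarrow> 'i operator \<Rightarrow> bool" where
  "unitary_op I U \<longleftrightarrow>
     (\<forall>i\<in>I. \<forall>j\<in>I. ((\<lambda>k. U i k * cnj (U j k)) has_sum id_op i j) I) \<and>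
     (\<forall>i\<in>I. \<forall>j\<in>I. ((\<lambda>k. cnj (U k i) * U k j) has_sum id_op i j) I)"

text \<open>
  Von Neumann entropy in bits: \<open>\<rho> = U diag(l) U\<^sup>*\<close> and \<open>h = - \<Sum> l log l\<close>. By the spectral theorem
  every density operator is diagonalised in this way, and the eigenvalues with their multiplicities
  are unique; so a value \<open>h\<close> exists unless the entropy is infinite, and it is unique. The convention
  \<open>0 log 0 = 0\<close> holds because of the factor \<open>l k\<close>.
\<close>

definition has_entropy :: "'i set \<Rightarrow> 'i operator \<Rightarrow> real \<Rightarrow> bool" where
  "has_entropy I \<rho> h \<longleftrightarrow>
     (\<exists>U l. unitary_op I U \<and> (\<forall>k\<in>I. 0 \<le> l k) \<and>
        (\<forall>i\<in>I. \<forall>j\<in>I. ((\<lambda>k. U i k * complex_of_real (l k) * cnj (U j k)) has_sum \<rho> i j) I) \<and>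
        ((\<lambda>k. - (l k * log 2 (l k))) has_sum h) I)"

text \<open>\<open>H(A|E) = H(AE) - H(E)\<close>, for a state on the space over \<open>A \<times> E\<close>.\<close>

definition has_cond_entropy :: "'a set \<Rightarrow> 'e set \<Rightarrow> ('a \<times> 'e) operator \<Rightarrow> real \<Rightarrow> bool" where
  "has_cond_entropy A E \<rho> h \<longleftrightarrow>
     (\<exists>hAE hE. has_entropy (A \<times> E) \<rho> hAE \<and> has_entropy E (trace_out_fst A \<rho>) hE \<and>
        h = hAE - hE)"

text \<open>
  The values \<open>H(A|X=x,E)\<close> attained by strategies and purifications with the prescribed four
  correlators, where the three Hilbert spaces range over all separable ones.
\<close>

definition eve_entropies :: "real \<Rightarrow> real \<Rightarrow> real \<Rightarrow> nat \<Rightarrow> real set" where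
  "eve_entropies \<theta> \<phi> \<omega> x =
     {h. \<exists>(IA :: nat set) (IB :: nat set) (E :: nat set) \<rho> M N \<Psi>.
           quantum_strategy IA IB \<rho> M N \<and>
           has_target_correlators \<theta> \<phi> \<omega> (generated_behaviour IA IB \<rho> M N) \<and>
           purification (IA \<times> IB) E \<Psi> \<rho> \<and>
           has_cond_entropy {0, 1} E (cq_state IA IB E (\<lambda>a. M a x) \<Psi>) h}"

text \<open>\<open>H(A|X=x,Y=y,B)\<close>; a summand with \<open>p a b x y = 0\<close> vanishes.\<close>

definition cond_shannon_entropy :: "behaviour \<Rightarrow> nat \<Rightarrow> nat \<Rightarrow> real" where
  "cond_shannon_entropy p x y =
     - (\<Sum>a\<in>{0, 1}. \<Sum>b\<in>{0, 1}. p a b x y * log 2 (p a b x y / (\<Sum>a'\<in>{0, 1}. p a' b x y)))"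

definition key_rate :: "real \<Rightarrow> real \<Rightarrow> real \<Rightarrow> behaviour \<Rightarrow> real" where
  "key_rate \<theta> \<phi> \<omega> p =
     Max ((\<lambda>(x, y). Inf (eve_entropies \<theta> \<phi> \<omega> x) - cond_shannon_entropy p x y) ` ({0, 1} \<times> {0, 1}))"

end

theory Submission
  imports Defs
begin

text \<open>The combination \<open>2 c A_0 - A_1\<close> comes from plane geometry: the target
  correlators are the cosines of the angles between unit vectors at 0 and \<open>t\<close> for Alice
  and at 0 and \<open>-t\<close> for Bob, and the vector at \<open>-t\<close> is the mirror image of
  the one at \<open>t\<close> in the one at 0, that is, \<open>2 c\<close> times the latter minus
  the former. The values \<open>c = 0\<close> and \<open>c = 1\<close> have to be avoided, because
  the argument divides by \<open>c\<close> and by \<open>1 - c\<^sup>2\<close>.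

  The case of two different indices \<open>e\<close> and \<open>f\<close> matters because these
  inner products enter the off-diagonal entries of Eve's states conditioned on Alice's outcome.

  Two obstacles account for most of the work. Strategies live on spaces of any countable dimension
  and are given by matrices, so every exchange of sums needs its own convergence argument. And
  entropy is specified by the existence of some diagonalisation: a value \<open>H(AE)\<close> may
  come from an eigenbasis that is unrelated to the product basis in which it is computed, so the
  entropy must first be shown to be independent of the eigenbasis.\<close>

text \<open>
  Put \<open>c = cos t\<close> with \<open>s = 2 + 2 c - 2 c\<^sup>2\<close>, \<open>\<phi> = \<pi>/2\<close>, \<open>\<omega> = \<pi>/2 - t\<close>, \<open>\<theta> = -t\<close>, so that the correlators
  are \<open>1, c, c, 2 c\<^sup>2 - 1\<close>. For a purification with components \<open>\<psi>\<^sub>e\<close> along Eve's basis they say that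
  certain sums of squared norms vanish, hence \<open>B\<^sub>0 \<psi>\<^sub>e = A\<^sub>0 \<psi>\<^sub>e\<close> and \<open>B\<^sub>1 \<psi>\<^sub>e = (2 c A\<^sub>0 - A\<^sub>1) \<psi>\<^sub>e\<close>.
  These relations force \<open>\<langle>\<psi>\<^sub>e, A\<^sub>x \<psi>\<^sub>f\<rangle> = 0\<close> for all \<open>e, f\<close>, which means that Alice's outcome is uniform and
  independent of Eve: \<open>H(A|X=x,E) = 1\<close> for both \<open>x\<close>. A maximally entangled pair of qubits attains
  the correlators, and there \<open>A\<^sub>0\<close> and \<open>B\<^sub>0\<close> agree perfectly, so that the error correction term vanishes
  for \<open>x = y = 0\<close>.
\<close>

section \<open>Square-summable vectors and unitary matrices\<close>

lemma has_sum_finite_sum: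
  fixes f :: "'j \<Rightarrow> 'i \<Rightarrow> 'a::topological_comm_monoid_add"
  assumes "finite F" "\<And>j. j \<in> F \<Longrightarrow> (f j has_sum s j) I"
  shows "((\<lambda>i. \<Sum>j\<in>F. f j i) has_sum (\<Sum>j\<in>F. s j)) I"
  using assms by (induction F) (auto intro!: has_sum_add)

lemma has_sum_diff:
  fixes f g :: "'i \<Rightarrow> 'a::topological_ab_group_add"
  assumes "(f has_sum a) I" "(g has_sum b) I"
  shows "((\<lambda>i. f i - g i) has_sum a - b) I"
  using has_sum_add[OF assms(1), of "\<lambda>i. - g i" "- b"] assms(2) by (simp add: has_sum_uminus)

definition square_summable_on :: "('i \<Rightarrow> complex) \<Rightarrow> 'i set \<Rightarrow> bool" (infixr "square'_summable'_on" 46) where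
  "x square_summable_on I \<longleftrightarrow> (\<lambda>i. (cmod (x i))\<^sup>2) summable_on I"

definition norm_sq :: "'i set \<Rightarrow> ('i \<Rightarrow> complex) \<Rightarrow> real" where
  "norm_sq I x = (\<Sum>\<^sub>\<infinity>i\<in>I. (cmod (x i))\<^sup>2)"

text \<open>Vanishing outside \<open>I\<close> leaves one function per vector, so that equations
  between vectors are equations between functions and can be used for rewriting.
  \<open>op_apply\<close> is cut off outside \<open>I\<close> for the same reason.\<close>

definition l2_on :: "'i set \<Rightarrow> ('i \<Rightarrow> complex) \<Rightarrow> bool" where
  "l2_on I x \<longleftrightarrow> x square_summable_on I \<and> (\<forall>i. i \<notin> I \<longrightarrow> x i = 0)"

definition inner_on :: "'i set \<Rightarrow> ('i \<Rightarrow> complex) \<Rightarrow> ('i \<Rightarrow> complex) \<Rightarrow> complex" where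
  "inner_on I x y = (\<Sum>\<^sub>\<infinity>i\<in>I. cnj (x i) * y i)"

definition op_apply :: "'i set \<Rightarrow> 'i operator \<Rightarrow> ('i \<Rightarrow> complex) \<Rightarrow> 'i \<Rightarrow> complex" where
  "op_apply I T x i = (if i \<in> I then \<Sum>\<^sub>\<infinity>k\<in>I. T i k * x k else 0)"

definition adjoint_op :: "'i operator \<Rightarrow> 'i operator" where
  "adjoint_op T i j = cnj (T j i)"

section \<open>Cauchy-Schwarz and bounded functionals\<close>

lemma norm_sq_nonneg: "0 \<le> norm_sq I x"
  unfolding norm_sq_def by (rule infsum_nonneg) simp

lemma Cauchy_Schwarz_abs_summable:
  assumes "x square_summable_on I" "y square_summable_on I"
  shows "(\<lambda>i. cmod (x i * y i)) summable_on I"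
  by (rule abs_summable_product)
    (use assms in \<open>simp_all add: square_summable_on_def norm_mult power2_eq_square\<close>)

lemma Cauchy_Schwarz_summable:
  assumes "x square_summable_on I" "y square_summable_on I"
  shows "(\<lambda>i. x i * y i) summable_on I"
  using Cauchy_Schwarz_abs_summable[OF assms] by (rule abs_summable_summable)

lemma Cauchy_Schwarz_infsum:
  assumes x: "x square_summable_on I" and y: "y square_summable_on I"
  shows "cmod (\<Sum>\<^sub>\<infinity>i\<in>I. x i * y i) \<le> sqrt (norm_sq I x) * sqrt (norm_sq I y)"
proof -
  have "cmod (\<Sum>\<^sub>\<infinity>i\<in>I. x i * y i) \<le> (\<Sum>\<^sub>\<infinity>i\<in>I. cmod (x i * y i))"
    by (rule norm_infsum_bound) (rule Cauchy_Schwarz_abs_summable[OF x y])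
  also have "\<dots> \<le> sqrt (norm_sq I x) * sqrt (norm_sq I y)"
  proof (rule infsum_le_finite_sums)
    show "(\<lambda>i. cmod (x i * y i)) summable_on I"
      by (rule Cauchy_Schwarz_abs_summable[OF x y])
    fix F assume F: "finite F" "F \<subseteq> I"
    have "(\<Sum>i\<in>F. cmod (x i * y i)) = (\<Sum>i\<in>F. \<bar>cmod (x i)\<bar> * \<bar>cmod (y i)\<bar>)"
      by (simp add: norm_mult)
    also have "\<dots> \<le> L2_set (\<lambda>i. cmod (x i)) F * L2_set (\<lambda>i. cmod (y i)) F"
      by (rule L2_set_mult_ineq)
    also have "\<dots> \<le> sqrt (norm_sq I x) * sqrt (norm_sq I y)"
      unfolding L2_set_def norm_sq_def
      using x y F
      by (intro mult_mono real_sqrt_le_mono finite_sum_le_infsum)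
        (auto simp: square_summable_on_def intro!: sum_nonneg infsum_nonneg)
    finally show "(\<Sum>i\<in>F. cmod (x i * y i)) \<le> sqrt (norm_sq I x) * sqrt (norm_sq I y)" .
  qed
  finally show ?thesis .
qed

lemma square_summable_cnj [simp]:
  "(\<lambda>i. cnj (x i)) square_summable_on I \<longleftrightarrow> x square_summable_on I"
  by (simp add: square_summable_on_def)

lemma norm_sq_cnj [simp]: "norm_sq I (\<lambda>i. cnj (x i)) = norm_sq I x"
  by (simp add: norm_sq_def)

lemma square_summable_cmult:
  "x square_summable_on I \<Longrightarrow> (\<lambda>i. c * x i) square_summable_on I"
  by (simp add: square_summable_on_def norm_mult power_mult_distrib summable_on_cmult_right)

lemma square_summable_add:
  assumes "x square_summable_on I" "y square_summable_on I"
  shows "(\<lambda>i. x i + y i) square_summable_on I"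
  unfolding square_summable_on_def
proof (rule summable_on_comparison_test)
  show "(\<lambda>i. 2 * (cmod (x i))\<^sup>2 + 2 * (cmod (y i))\<^sup>2) summable_on I"
    using assms unfolding square_summable_on_def
    by (intro summable_on_add summable_on_cmult_right)
  fix i
  have "(cmod (x i + y i))\<^sup>2 \<le> (cmod (x i) + cmod (y i))\<^sup>2"
    by (intro power_mono norm_triangle_ineq) simp
  also have "\<dots> \<le> 2 * (cmod (x i))\<^sup>2 + 2 * (cmod (y i))\<^sup>2"
    using sum_squares_bound[of "cmod (x i)" "cmod (y i)"] by (simp add: power2_sum)
  finally show "(cmod (x i + y i))\<^sup>2 \<le> 2 * (cmod (x i))\<^sup>2 + 2 * (cmod (y i))\<^sup>2" .
qed simp

lemma l2_on_add: "l2_on I x \<Longrightarrow> l2_on I y \<Longrightarrow> l2_on I (\<lambda>i. x i + y i)"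
  by (simp add: l2_on_def square_summable_add)

lemma l2_on_cmult: "l2_on I x \<Longrightarrow> l2_on I (\<lambda>i. c * x i)"
  by (simp add: l2_on_def square_summable_cmult)

lemma l2_on_diff: "l2_on I x \<Longrightarrow> l2_on I y \<Longrightarrow> l2_on I (\<lambda>i. x i - y i)"
  using l2_on_add[of I x "\<lambda>i. (-1) * y i"] l2_on_cmult[of I y "-1"] by simp

lemma l2_on_finite:
  assumes "finite F" "F \<subseteq> I"
  shows "l2_on I (\<lambda>i. if i \<in> F then x i else 0)"
proof -
  have "(\<lambda>i. (cmod (if i \<in> F then x i else 0))\<^sup>2) summable_on I"
    by (rule finite_nonzero_values_imp_summable_on, rule finite_subset[OF _ assms(1)]) auto
  then show ?thesis using assms(2) by (auto simp: l2_on_def square_summable_on_def)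
qed

lemma l2_on_ket: "j \<in> I \<Longrightarrow> l2_on I (ket j)"
  using l2_on_finite[of "{j}" I "\<lambda>_. 1"] by (simp add: ket_def[abs_def])

lemma cmod_le_sqrt_norm_sq:
  assumes "l2_on I x"
  shows "cmod (x i) \<le> sqrt (norm_sq I x)"
proof (cases "i \<in> I")
  case True
  have "(\<Sum>j\<in>{i}. (cmod (x j))\<^sup>2) \<le> norm_sq I x"
    unfolding norm_sq_def
    by (rule finite_sum_le_infsum) (use assms True in \<open>auto simp: l2_on_def square_summable_on_def\<close>)
  then show ?thesis by (simp add: real_le_rsqrt)
next
  case False
  then show ?thesis using assms by (simp add: l2_on_def norm_sq_nonneg)
qed

text \<open>On the truncation of \<open>x\<close> to a finite set the functional is a partial sum of
  the series, and on the remainder it is at most \<open>C\<close> times a norm that tends to 0.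
  Later this replaces exchanges of summation that may lack absolute convergence: a bounded
  functional is determined by its values on the vectors \<open>ket j\<close>.\<close>

lemma bounded_functional_has_sum:
  assumes bound: "\<And>x. l2_on I x \<Longrightarrow> cmod (L x) \<le> C * sqrt (norm_sq I x)"
    and add: "\<And>x y. l2_on I x \<Longrightarrow> l2_on I y \<Longrightarrow> L (\<lambda>i. x i + y i) = L x + L y"
    and cmult: "\<And>c x. l2_on I x \<Longrightarrow> L (\<lambda>i. c * x i) = c * L x"
    and x: "l2_on I x"
  shows "((\<lambda>j. x j * L (ket j)) has_sum L x) I"
proof -
  have L0: "L (\<lambda>i. 0) = 0"
    using cmult[OF x, of 0] by simp
  have fin: "L (\<lambda>i. if i \<in> F then x i else 0) = (\<Sum>j\<in>F. x j * L (ket j))" if "finite F" "F \<subseteq> I" for F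
    using that
  proof (induction F)
    case (insert j F)
    have "(\<lambda>i. if i \<in> insert j F then x i else 0)
        = (\<lambda>i. x j * ket j i + (if i \<in> F then x i else 0))"
      using insert by (auto simp: ket_def fun_eq_iff)
    then show ?case
      using insert by (simp add: add cmult l2_on_cmult l2_on_finite l2_on_ket)
  qed (simp add: L0)
  have err: "cmod ((\<Sum>j\<in>F. x j * L (ket j)) - L x)
      \<le> C * sqrt (norm_sq I x - (\<Sum>i\<in>F. (cmod (x i))\<^sup>2))" if F: "finite F" "F \<subseteq> I" for F
  proof -
    let ?r = "\<lambda>i. x i - (if i \<in> F then x i else 0)"
    have r: "l2_on I ?r" by (intro l2_on_diff x l2_on_finite F)
    have "x = (\<lambda>i. ?r i + (if i \<in> F then x i else 0))" by simp
    hence "L x = L ?r + (\<Sum>j\<in>F. x j * L (ket j))"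
      using add[OF r l2_on_finite[OF F, of x]] fin[OF F] by simp
    hence "cmod ((\<Sum>j\<in>F. x j * L (ket j)) - L x) = cmod (L ?r)"
      by (simp add: norm_minus_commute)
    also have "\<dots> \<le> C * sqrt (norm_sq I ?r)" by (rule bound[OF r])
    also have "norm_sq I ?r = norm_sq I x - (\<Sum>i\<in>F. (cmod (x i))\<^sup>2)"
    proof -
      have "norm_sq I ?r = norm_sq I x + (\<Sum>\<^sub>\<infinity>i\<in>I. - (if i \<in> F then (cmod (x i))\<^sup>2 else 0))"
        unfolding norm_sq_def
      proof (subst infsum_add[symmetric])
        show "(\<lambda>i. - (if i \<in> F then (cmod (x i))\<^sup>2 else 0)) summable_on I"
          by (rule finite_nonzero_values_imp_summable_on, rule finite_subset[OF _ F(1)]) auto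
      qed (use x in \<open>auto simp: l2_on_def square_summable_on_def intro!: infsum_cong\<close>)
      also have "(\<Sum>\<^sub>\<infinity>i\<in>I. - (if i \<in> F then (cmod (x i))\<^sup>2 else 0)) = (\<Sum>\<^sub>\<infinity>i\<in>F. - (cmod (x i))\<^sup>2)"
        by (rule infsum_cong_neutral) (use F in auto)
      finally show ?thesis using F by (simp add: sum_negf)
    qed
    finally show ?thesis .
  qed
  have "((\<lambda>i. (cmod (x i))\<^sup>2) has_sum norm_sq I x) I"
    unfolding norm_sq_def using x by (simp add: l2_on_def square_summable_on_def)
  hence "((\<lambda>F. \<Sum>i\<in>F. (cmod (x i))\<^sup>2) \<longlongrightarrow> norm_sq I x) (finite_subsets_at_top I)"
    by (simp add: has_sum_def)
  hence "((\<lambda>F. C * sqrt (norm_sq I x - (\<Sum>i\<in>F. (cmod (x i))\<^sup>2))) \<longlongrightarrow> C * sqrt (norm_sq I x - norm_sq I x))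
      (finite_subsets_at_top I)"
    by (intro tendsto_intros)
  hence lim: "((\<lambda>F. C * sqrt (norm_sq I x - (\<Sum>i\<in>F. (cmod (x i))\<^sup>2))) \<longlongrightarrow> 0) (finite_subsets_at_top I)"
    by simp
  have "((\<lambda>F. (\<Sum>j\<in>F. x j * L (ket j)) - L x) \<longlongrightarrow> 0) (finite_subsets_at_top I)"
    by (rule Lim_null_comparison[OF _ lim])
      (rule eventually_finite_subsets_at_top_weakI, rule err)
  then show ?thesis
    unfolding has_sum_def by (simp add: LIM_zero_iff)
qed

section \<open>Unitary matrices as isometries\<close>

lemma unitary_op_row:
  assumes "unitary_op I T" "i \<in> I"
  shows "T i square_summable_on I" "norm_sq I (T i) = 1"
proof -
  have "((\<lambda>k. T i k * cnj (T i k)) has_sum 1) I"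
    using assms unfolding unitary_op_def id_op_def by fastforce
  hence "((\<lambda>k. complex_of_real ((cmod (T i k))\<^sup>2)) has_sum of_real 1) I"
    by (simp add: complex_norm_square[symmetric] del: of_real_power)
  hence "((\<lambda>k. (cmod (T i k))\<^sup>2) has_sum 1) I"
    by (simp only: has_sum_of_real_iff)
  then show "T i square_summable_on I" "norm_sq I (T i) = 1"
    by (auto simp: square_summable_on_def norm_sq_def has_sum_iff)
qed

lemma unitary_op_adjoint: "unitary_op I T \<Longrightarrow> unitary_op I (adjoint_op T)"
  by (auto simp: unitary_op_def adjoint_op_def)

lemma op_apply_has_sum:
  assumes "unitary_op I T" "l2_on I x" "i \<in> I"
  shows "((\<lambda>k. T i k * x k) has_sum op_apply I T x i) I"
  using Cauchy_Schwarz_summable[OF unitary_op_row(1)[OF assms(1,3)], of x] assms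
  by (simp add: op_apply_def l2_on_def)

lemma op_apply_add:
  assumes "unitary_op I T" "l2_on I x" "l2_on I y"
  shows "op_apply I T (\<lambda>i. x i + y i) = (\<lambda>i. op_apply I T x i + op_apply I T y i)"
proof
  fix i
  show "op_apply I T (\<lambda>i. x i + y i) i = op_apply I T x i + op_apply I T y i"
  proof (cases "i \<in> I")
    case True
    have "((\<lambda>k. T i k * (x k + y k)) has_sum op_apply I T x i + op_apply I T y i) I"
      using has_sum_add[OF op_apply_has_sum[OF assms(1,2) True] op_apply_has_sum[OF assms(1,3) True]]
      by (simp add: distrib_left)
    then show ?thesis using True by (simp add: op_apply_def has_sum_iff)
  qed (simp add: op_apply_def)
qed

lemma op_apply_cmult:
  "op_apply I T (\<lambda>i. c * x i) = (\<lambda>i. c * op_apply I T x i)"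
  by (auto simp: op_apply_def fun_eq_iff mult.left_commute infsum_cmult_right')

lemma op_apply_diff:
  assumes "unitary_op I T" "l2_on I x" "l2_on I y"
  shows "op_apply I T (\<lambda>i. x i - y i) = (\<lambda>i. op_apply I T x i - op_apply I T y i)"
  using op_apply_add[OF assms(1,2) l2_on_cmult[OF assms(3), of "-1"]] op_apply_cmult[of I T "-1" y]
  by simp

lemma op_apply_ket: "i \<in> I \<Longrightarrow> j \<in> I \<Longrightarrow> op_apply I T (ket j) i = T i j"
proof -
  assume i: "i \<in> I" and j: "j \<in> I"
  have "(\<Sum>\<^sub>\<infinity>k\<in>I. T i k * ket j k) = (\<Sum>\<^sub>\<infinity>k\<in>{j}. T i k * ket j k)"
    by (rule infsum_cong_neutral) (use j in \<open>auto simp: ket_def\<close>)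
  then show ?thesis using i by (simp add: op_apply_def ket_def)
qed

text \<open>Up to conjugation the family under the modulus is the adjoint of \<open>T\<close>
  applied to a vector supported on \<open>F\<close>. It is a finite combination of orthonormal rows,
  so its norm follows by expanding the square.\<close>

lemma unitary_op_finite_norm:
  assumes T: "unitary_op I T" and F: "finite F" "F \<subseteq> I"
  shows "((\<lambda>k. (cmod (\<Sum>i\<in>F. cnj (y i) * T i k))\<^sup>2) has_sum (\<Sum>i\<in>F. (cmod (y i))\<^sup>2)) I"
proof -
  have "((\<lambda>k. \<Sum>i\<in>F. \<Sum>j\<in>F. cnj (y i) * y j * (T i k * cnj (T j k)))
      has_sum (\<Sum>i\<in>F. \<Sum>j\<in>F. cnj (y i) * y j * id_op i j)) I"
    using T F unfolding unitary_op_def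
    by (intro has_sum_finite_sum has_sum_cmult_right) (blast intro: F)+
  also have "(\<lambda>k. \<Sum>i\<in>F. \<Sum>j\<in>F. cnj (y i) * y j * (T i k * cnj (T j k)))
      = (\<lambda>k. complex_of_real ((cmod (\<Sum>i\<in>F. cnj (y i) * T i k))\<^sup>2))"
    unfolding complex_norm_square cnj_sum sum_product by (simp add: ac_simps)
  also have "(\<Sum>i\<in>F. \<Sum>j\<in>F. cnj (y i) * y j * id_op i j) = (\<Sum>i\<in>F. cnj (y i) * y i)"
    using F by (simp add: id_op_def if_distrib cong: if_cong)
  also have "\<dots> = complex_of_real (\<Sum>i\<in>F. (cmod (y i))\<^sup>2)"
    by (simp only: complex_norm_square of_real_sum mult.commute)
  finally show ?thesis by (simp only: has_sum_of_real_iff)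
qed

text \<open>A self-bounding argument: a partial sum \<open>S\<close> of the squared entries of
  \<open>T x\<close> is the pairing of a truncation of \<open>T x\<close> with \<open>T x\<close>
  itself. With \<open>T\<close> moved to the other side it pairs a vector of squared norm
  \<open>S\<close> with \<open>x\<close>, so Cauchy-Schwarz gives
  \<open>S \<le> sqrt S * sqrt (norm_sq I x)\<close>, a bound on \<open>S\<close> that does not
  depend on \<open>F\<close>.\<close>

lemma
  assumes T: "unitary_op I T" and x: "l2_on I x"
  shows l2_on_op_apply: "l2_on I (op_apply I T x)"
    and norm_sq_op_apply_le: "norm_sq I (op_apply I T x) \<le> norm_sq I x"
proof -
  let ?y = "op_apply I T x"
  have fin: "(\<Sum>i\<in>F. (cmod (?y i))\<^sup>2) \<le> norm_sq I x" if F: "finite F" "F \<subseteq> I" for F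
  proof -
    define S where "S = (\<Sum>i\<in>F. (cmod (?y i))\<^sup>2)"
    define z where "z k = (\<Sum>i\<in>F. cnj (?y i) * T i k)" for k
    have z: "z square_summable_on I" "norm_sq I z = S"
      using unitary_op_finite_norm[OF T F, of ?y]
      by (auto simp: square_summable_on_def norm_sq_def has_sum_iff z_def S_def)
    have "((\<lambda>k. \<Sum>i\<in>F. cnj (?y i) * (T i k * x k)) has_sum (\<Sum>i\<in>F. cnj (?y i) * ?y i)) I"
      using F by (intro has_sum_finite_sum has_sum_cmult_right op_apply_has_sum T x) auto
    hence "((\<lambda>k. z k * x k) has_sum complex_of_real S) I"
      unfolding S_def of_real_sum complex_norm_square z_def
      by (simp add: sum_distrib_left sum_distrib_right ac_simps)
    hence "cmod (complex_of_real S) \<le> sqrt S * sqrt (norm_sq I x)"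
      using Cauchy_Schwarz_infsum[OF z(1), of x] x z(2) by (simp add: l2_on_def has_sum_iff)
    moreover have "0 \<le> S" unfolding S_def by (intro sum_nonneg) simp
    ultimately have "sqrt S * sqrt S \<le> sqrt S * sqrt (norm_sq I x)" and "0 \<le> S" by simp_all
    hence "S \<le> norm_sq I x"
      using norm_sq_nonneg[of I x]
      by (cases "S = 0") (simp_all add: mult_le_cancel_left_pos del: real_sqrt_mult_self)
    then show ?thesis by (simp add: S_def)
  qed
  have "(\<lambda>i. (cmod (?y i))\<^sup>2) summable_on I"
    by (rule nonneg_bdd_above_summable_on) (use fin in \<open>auto intro!: bdd_aboveI2\<close>)
  then show "l2_on I ?y" "norm_sq I ?y \<le> norm_sq I x"
    using fin by (auto simp: l2_on_def square_summable_on_def op_apply_def norm_sq_def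
        intro!: infsum_le_finite_sums)
qed

text \<open>The double series behind the left-hand side need not converge absolutely, so its sums
  cannot simply be exchanged. Instead, each coordinate of the left-hand side is a functional of
  \<open>x\<close> bounded by the norm, and its values on basis vectors are the entries of
  \<open>V\<close>.\<close>

lemma op_apply_compose:
  assumes S: "unitary_op I S" and T: "unitary_op I T"
    and V: "\<And>i j. i \<in> I \<Longrightarrow> j \<in> I \<Longrightarrow> ((\<lambda>k. S i k * T k j) has_sum V i j) I"
    and x: "l2_on I x"
  shows "op_apply I S (op_apply I T x) = op_apply I V x"
proof
  fix i
  show "op_apply I S (op_apply I T x) i = op_apply I V x i"
  proof (cases "i \<in> I")
    case True
    have "((\<lambda>j. x j * op_apply I S (op_apply I T (ket j)) i) has_sum op_apply I S (op_apply I T x) i) I"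
    proof (rule bounded_functional_has_sum[where C = 1, OF _ _ _ x])
      fix x :: "'a \<Rightarrow> complex" assume x: "l2_on I x"
      show "cmod (op_apply I S (op_apply I T x) i) \<le> 1 * sqrt (norm_sq I x)"
        using cmod_le_sqrt_norm_sq[OF l2_on_op_apply[OF S l2_on_op_apply[OF T x]], of i]
          norm_sq_op_apply_le[OF S l2_on_op_apply[OF T x]] norm_sq_op_apply_le[OF T x]
        by (smt (verit) real_sqrt_le_iff)
    qed (simp_all add: op_apply_add op_apply_cmult S T l2_on_op_apply)
    also have "?this \<longleftrightarrow> ((\<lambda>j. V i j * x j) has_sum op_apply I S (op_apply I T x) i) I"
    proof (rule has_sum_cong)
      fix j assume j: "j \<in> I"
      have "op_apply I S (op_apply I T (ket j)) i = (\<Sum>\<^sub>\<infinity>k\<in>I. S i k * T k j)"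
        using True j by (simp add: op_apply_def[of I S] op_apply_ket cong: infsum_cong)
      also have "\<dots> = V i j" using V[OF True j] by (simp add: has_sum_iff)
      finally show "x j * op_apply I S (op_apply I T (ket j)) i = V i j * x j" by simp
    qed
    finally show ?thesis using True by (simp add: op_apply_def[of I V] has_sum_iff)
  qed (simp add: op_apply_def)
qed

lemma op_apply_id_op: "l2_on I x \<Longrightarrow> op_apply I id_op x = x"
proof
  fix i assume x: "l2_on I x"
  show "op_apply I id_op x i = x i"
  proof (cases "i \<in> I")
    case True
    have "(\<Sum>\<^sub>\<infinity>k\<in>I. id_op i k * x k) = (\<Sum>\<^sub>\<infinity>k\<in>{i}. id_op i k * x k)"
      by (rule infsum_cong_neutral) (use True in \<open>auto simp: id_op_def\<close>)
    then show ?thesis using True by (simp add: op_apply_def id_op_def)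
  qed (use x in \<open>simp add: op_apply_def l2_on_def\<close>)
qed

lemma op_apply_adjoint_cancel:
  assumes T: "unitary_op I T" and x: "l2_on I x"
  shows "op_apply I (adjoint_op T) (op_apply I T x) = x"
proof -
  have "op_apply I (adjoint_op T) (op_apply I T x) = op_apply I id_op x"
    using T by (intro op_apply_compose unitary_op_adjoint x) (auto simp: adjoint_op_def unitary_op_def)
  then show ?thesis by (simp add: op_apply_id_op x)
qed

section \<open>Inner products and adjoints\<close>

lemma inner_on_has_sum:
  assumes "l2_on I x" "l2_on I y"
  shows "((\<lambda>i. cnj (x i) * y i) has_sum inner_on I x y) I"
  using Cauchy_Schwarz_summable[of "\<lambda>i. cnj (x i)" I y] assms by (simp add: inner_on_def l2_on_def)

lemma inner_on_add:
  assumes "l2_on I x" "l2_on I y" "l2_on I z"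
  shows "inner_on I x (\<lambda>i. y i + z i) = inner_on I x y + inner_on I x z"
  using has_sum_add[OF inner_on_has_sum[OF assms(1,2)] inner_on_has_sum[OF assms(1,3)]]
  by (simp add: inner_on_def[of I x "\<lambda>i. y i + z i"] distrib_left has_sum_iff)

lemma inner_on_cmult: "inner_on I x (\<lambda>i. c * y i) = c * inner_on I x y"
  by (simp add: inner_on_def mult.left_commute infsum_cmult_right')

lemma inner_on_diff:
  assumes "l2_on I x" "l2_on I y" "l2_on I z"
  shows "inner_on I x (\<lambda>i. y i - z i) = inner_on I x y - inner_on I x z"
  using inner_on_add[OF assms(1,2) l2_on_cmult[OF assms(3), of "-1"]] inner_on_cmult[of I x "-1" z]
  by simp

lemma cnj_inner_on: "cnj (inner_on I x y) = inner_on I y x"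
  by (simp add: inner_on_def infsum_cnj[symmetric] mult.commute)

lemma Re_inner_on_commute: "Re (inner_on I x y) = Re (inner_on I y x)"
  by (subst cnj_inner_on[symmetric]) simp

lemma inner_on_self:
  assumes "l2_on I x"
  shows "inner_on I x x = complex_of_real (norm_sq I x)"
proof -
  have "inner_on I x x = (\<Sum>\<^sub>\<infinity>i\<in>I. complex_of_real ((cmod (x i))\<^sup>2))"
    by (simp only: inner_on_def complex_norm_square mult.commute)
  also have "\<dots> = complex_of_real (norm_sq I x)"
    using l2_on_def assms
    by (intro infsumI) (simp only: has_sum_of_real_iff norm_sq_def l2_on_def square_summable_on_def has_sum_infsum)
  finally show ?thesis .
qed

lemma cmod_inner_on_le:
  assumes "l2_on I x" "l2_on I y"
  shows "cmod (inner_on I x y) \<le> sqrt (norm_sq I x) * sqrt (norm_sq I y)"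
  using Cauchy_Schwarz_infsum[of "\<lambda>i. cnj (x i)" I y] assms by (simp add: inner_on_def l2_on_def)

lemma norm_sq_diff:
  assumes "l2_on I x" "l2_on I y"
  shows "norm_sq I (\<lambda>i. x i - y i) = norm_sq I x + norm_sq I y - 2 * Re (inner_on I x y)"
proof -
  have "complex_of_real (norm_sq I (\<lambda>i. x i - y i))
      = inner_on I (\<lambda>i. x i - y i) x - inner_on I (\<lambda>i. x i - y i) y"
    using inner_on_diff[OF l2_on_diff[OF assms] assms] inner_on_self[OF l2_on_diff[OF assms]] by simp
  also have "\<dots> = cnj (inner_on I x (\<lambda>i. x i - y i)) - cnj (inner_on I y (\<lambda>i. x i - y i))"
    by (simp only: cnj_inner_on)
  also have "\<dots> = norm_sq I x + norm_sq I y - (inner_on I x y + cnj (inner_on I x y))"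
    using assms by (simp add: inner_on_diff inner_on_self cnj_inner_on)
  finally show ?thesis
    by (metis complex_add_cnj of_real_add of_real_diff of_real_eq_iff)
qed

lemma norm_sq_cmult: "norm_sq I (\<lambda>i. c * x i) = (cmod c)\<^sup>2 * norm_sq I x"
  by (simp add: norm_sq_def norm_mult power_mult_distrib infsum_cmult_right')

lemma norm_sq_eq_0_iff:
  assumes "l2_on I x"
  shows "norm_sq I x = 0 \<longleftrightarrow> x = (\<lambda>_. 0)"
  using cmod_le_sqrt_norm_sq[OF assms] by (auto simp: fun_eq_iff norm_sq_def)

text \<open>Again no exchange of sums: for fixed \<open>y\<close> the left-hand side is a bounded
  functional of \<open>x\<close>, determined by its values on basis vectors.\<close>

lemma inner_on_adjoint:
  assumes T: "unitary_op I T" and x: "l2_on I x" and y: "l2_on I y"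
  shows "inner_on I y (op_apply I T x) = inner_on I (op_apply I (adjoint_op T) y) x"
proof -
  have "((\<lambda>j. x j * inner_on I y (op_apply I T (ket j))) has_sum inner_on I y (op_apply I T x)) I"
  proof (rule bounded_functional_has_sum[where C = "sqrt (norm_sq I y)", OF _ _ _ x])
    fix x :: "'a \<Rightarrow> complex" assume x: "l2_on I x"
    have "cmod (inner_on I y (op_apply I T x)) \<le> sqrt (norm_sq I y) * sqrt (norm_sq I (op_apply I T x))"
      by (intro cmod_inner_on_le y l2_on_op_apply T x)
    also have "\<dots> \<le> sqrt (norm_sq I y) * sqrt (norm_sq I x)"
      using norm_sq_op_apply_le[OF T x] by (intro mult_left_mono) (auto simp: norm_sq_nonneg)
    finally show "cmod (inner_on I y (op_apply I T x)) \<le> sqrt (norm_sq I y) * sqrt (norm_sq I x)" .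
  qed (simp_all add: op_apply_add op_apply_cmult T l2_on_op_apply inner_on_add inner_on_cmult y)
  also have "?this \<longleftrightarrow> ((\<lambda>j. cnj (op_apply I (adjoint_op T) y j) * x j)
      has_sum inner_on I y (op_apply I T x)) I"
  proof (rule has_sum_cong)
    fix j assume j: "j \<in> I"
    have "inner_on I y (op_apply I T (ket j)) = (\<Sum>\<^sub>\<infinity>k\<in>I. cnj (y k) * T k j)"
      using j by (simp add: inner_on_def op_apply_ket cong: infsum_cong)
    also have "\<dots> = cnj (op_apply I (adjoint_op T) y j)"
      using j by (simp add: op_apply_def adjoint_op_def infsum_cnj[symmetric] mult.commute)
    finally show "x j * inner_on I y (op_apply I T (ket j)) = cnj (op_apply I (adjoint_op T) y j) * x j"
      by simp
  qed
  finally show ?thesis by (simp add: inner_on_def has_sum_iff)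
qed

lemma norm_sq_op_apply:
  assumes "unitary_op I T" "l2_on I x"
  shows "norm_sq I (op_apply I T x) = norm_sq I x"
  using inner_on_adjoint[OF assms(1,2) l2_on_op_apply[OF assms]]
  by (simp add: op_apply_adjoint_cancel assms inner_on_self l2_on_op_apply)

section \<open>Uniqueness of the entropy\<close>

lemma norm_summable_on_Times:
  fixes f :: "'a \<times> 'b \<Rightarrow> 'c::real_normed_vector"
  assumes "\<And>i. i \<in> A \<Longrightarrow> ((\<lambda>j. norm (f (i, j))) has_sum g i) B" "g summable_on A"
  shows "(\<lambda>p. norm (f p)) summable_on A \<times> B"
  by (rule summable_on_SigmaI[where g = g]) (use assms in auto)

lemma has_sum_Times_mult:
  fixes f :: "'a \<Rightarrow> 'c::{banach, real_normed_algebra}"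
  assumes f: "(f has_sum a) A" "(\<lambda>i. norm (f i)) summable_on A"
    and g: "(g has_sum b) B" "(\<lambda>j. norm (g j)) summable_on B"
  shows "((\<lambda>p. f (fst p) * g (snd p)) has_sum a * b) (A \<times> B)"
proof (rule has_sum_SigmaI)
  show "((\<lambda>y. f (fst (x, y)) * g (snd (x, y))) has_sum f x * b) B" for x
    using g(1) by (simp add: has_sum_cmult_right)
  show "((\<lambda>x. f x * b) has_sum a * b) A"
    using f(1) by (rule has_sum_cmult_left)
  have "(\<lambda>p. norm (norm (f (fst p)) * norm (g (snd p)))) summable_on A \<times> B"
  proof (rule norm_summable_on_Times)
    show "((\<lambda>j. norm (norm (f (fst (i, j))) * norm (g (snd (i, j))))) has_sum
        norm (f i) * (\<Sum>\<^sub>\<infinity>j\<in>B. norm (g j))) B" for i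
      using g(2) by (simp add: has_sum_cmult_right)
    show "(\<lambda>i. norm (f i) * (\<Sum>\<^sub>\<infinity>j\<in>B. norm (g j))) summable_on A"
      using f(2) by (rule summable_on_cmult_left)
  qed
  hence "(\<lambda>p. norm (f (fst p) * g (snd p))) summable_on A \<times> B"
    by (rule Infinite_Sum.abs_summable_on_comparison_test') (simp add: norm_mult_ineq)
  then show "(\<lambda>p. f (fst p) * g (snd p)) summable_on A \<times> B"
    by (rule abs_summable_summable)
qed

lemma has_sum_Times_mult_complex:
  fixes f g :: "_ \<Rightarrow> complex"
  assumes "(f has_sum a) A" "(g has_sum b) B"
  shows "((\<lambda>p. f (fst p) * g (snd p)) has_sum a * b) (A \<times> B)"
  using assms
  by (intro has_sum_Times_mult) (auto simp: has_sum_iff summable_on_iff_abs_summable_on_complex)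

lemma has_sum_Times_mult_real:
  fixes f g :: "_ \<Rightarrow> real"
  assumes "(f has_sum a) A" "(g has_sum b) B"
  shows "((\<lambda>p. f (fst p) * g (snd p)) has_sum a * b) (A \<times> B)"
  by (rule has_sum_Times_mult[OF assms(1) _ assms(2)])
    (rule summable_on_iff_abs_summable_on_real[THEN iffD1], rule has_sum_imp_summable, rule assms)+

lemma unitary_op_id_op: "unitary_op I id_op"
proof -
  have "((\<lambda>k. id_op i k * cnj (id_op j k)) has_sum id_op i j) I" if "i \<in> I" for i j :: 'a
    by (rule has_sum_finite_neutralI[of "{i}"]) (use that in \<open>auto simp: id_op_def\<close>)
  moreover have "((\<lambda>k. cnj (id_op k i) * id_op k j) has_sum id_op i j) I" if "i \<in> I" for i j :: 'a
    by (rule has_sum_finite_neutralI[of "{i}"]) (use that in \<open>auto simp: id_op_def\<close>)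
  ultimately show ?thesis by (simp add: unitary_op_def)
qed

lemma unitary_op_tensor:
  assumes "unitary_op I S" "unitary_op J T"
  shows "unitary_op (I \<times> J) (tensor S T)"
proof -
  have id: "id_op (fst p) (fst q) * id_op (snd p) (snd q) = id_op p q" for p q :: "'a \<times> 'b"
    by (simp add: id_op_def prod_eq_iff)
  have "((\<lambda>k. tensor S T p k * cnj (tensor S T q k)) has_sum id_op p q) (I \<times> J)"
    if "p \<in> I \<times> J" "q \<in> I \<times> J" for p q
  proof -
    have "((\<lambda>k. S (fst p) k * cnj (S (fst q) k)) has_sum id_op (fst p) (fst q)) I"
      "((\<lambda>k. T (snd p) k * cnj (T (snd q) k)) has_sum id_op (snd p) (snd q)) J"
      using assms that unfolding unitary_op_def mem_Times_iff by blast+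
    from has_sum_Times_mult_complex[OF this] show ?thesis
      by (simp add: tensor_def id ac_simps)
  qed
  moreover have "((\<lambda>k. cnj (tensor S T k p) * tensor S T k q) has_sum id_op p q) (I \<times> J)"
    if "p \<in> I \<times> J" "q \<in> I \<times> J" for p q
  proof -
    have "((\<lambda>k. cnj (S k (fst p)) * S k (fst q)) has_sum id_op (fst p) (fst q)) I"
      "((\<lambda>k. cnj (T k (snd p)) * T k (snd q)) has_sum id_op (snd p) (snd q)) J"
      using assms that unfolding unitary_op_def mem_Times_iff by blast+
    from has_sum_Times_mult_complex[OF this] show ?thesis
      by (simp add: tensor_def id ac_simps)
  qed
  ultimately show ?thesis by (simp add: unitary_op_def)
qed

section \<open>Spectral decompositions with summable eigenvalues\<close>

definition diagonalises :: "'i set \<Rightarrow> 'i operator \<Rightarrow> ('i \<Rightarrow> real) \<Rightarrow> 'i operator \<Rightarrow> bool" where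
  "diagonalises I U l \<rho> \<longleftrightarrow> unitary_op I U \<and> (\<forall>k\<in>I. 0 \<le> l k) \<and>
     (\<forall>i\<in>I. \<forall>j\<in>I. ((\<lambda>k. U i k * complex_of_real (l k) * cnj (U j k)) has_sum \<rho> i j) I)"

lemma diagonalises_diagonal:
  assumes D: "diagonalises I U l \<rho>" and i: "i \<in> I"
  shows "((\<lambda>k. (cmod (U i k))\<^sup>2 * l k) has_sum Re (\<rho> i i)) I"
proof -
  have "((\<lambda>k. Re (U i k * complex_of_real (l k) * cnj (U i k))) has_sum Re (\<rho> i i)) I"
    using D i by (intro has_sum_Re) (simp add: diagonalises_def)
  moreover have "Re (U i k * complex_of_real (l k) * cnj (U i k)) = (cmod (U i k))\<^sup>2 * l k" for k
    unfolding cmod_power2 by (simp add: algebra_simps power2_eq_square)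
  ultimately show ?thesis by simp
qed

text \<open>The nonnegative array \<open>(cmod (U i k))\<^sup>2 * l k\<close> has the same total in
  both orders: its rows add up to the diagonal of \<open>\<rho>\<close>, its columns to the
  eigenvalues because the columns of \<open>U\<close> are unit vectors.\<close>

lemma diagonalises_trace:
  assumes D: "diagonalises I U l \<rho>" and tr: "((\<lambda>i. Re (\<rho> i i)) has_sum t) I"
  shows "(l has_sum t) I"
proof -
  have U: "unitary_op I U" and l: "\<And>k. k \<in> I \<Longrightarrow> 0 \<le> l k"
    using D by (auto simp: diagonalises_def)
  have "(\<lambda>(i, k). (cmod (U i k))\<^sup>2 * l k) summable_on I \<times> I"
    by (rule summable_on_SigmaI[where g = "\<lambda>i. Re (\<rho> i i)"])
      (use diagonalises_diagonal[OF D] tr l in \<open>auto simp: has_sum_iff\<close>)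
  hence "((\<lambda>(i, k). (cmod (U i k))\<^sup>2 * l k) has_sum t) (I \<times> I)"
    by (intro has_sum_SigmaI[where g = "\<lambda>i. Re (\<rho> i i)"] tr) (use diagonalises_diagonal[OF D] in auto)
  hence "((\<lambda>(k, i). (cmod (U i k))\<^sup>2 * l k) has_sum t) (I \<times> I)"
    by (subst (asm) has_sum_swap) (simp add: case_prod_unfold)
  then show ?thesis
  proof (rule has_sum_SigmaD)
    fix k assume k: "k \<in> I"
    have "((\<lambda>i. (cmod (U i k))\<^sup>2) has_sum 1) I"
      using unitary_op_row[OF unitary_op_adjoint[OF U] k]
      by (simp add: adjoint_op_def square_summable_on_def norm_sq_def has_sum_iff)
    from has_sum_cmult_left[OF this, of "l k"]
    show "((\<lambda>i. case (k, i) of (k, i) \<Rightarrow> (cmod (U i k))\<^sup>2 * l k) has_sum l k) I" by simp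
  qed
qed

lemma diagonalises_hermitian:
  assumes D: "diagonalises I U l \<rho>" and i: "i \<in> I" and j: "j \<in> I"
  shows "\<rho> j i = cnj (\<rho> i j)"
proof -
  have "((\<lambda>k. cnj (U i k * complex_of_real (l k) * cnj (U j k))) has_sum cnj (\<rho> i j)) I"
    unfolding has_sum_cnj_iff using D i j by (simp add: diagonalises_def)
  moreover have "((\<lambda>k. U j k * complex_of_real (l k) * cnj (U i k)) has_sum \<rho> j i) I"
    using D i j by (simp add: diagonalises_def)
  ultimately show ?thesis
    by (simp add: mult.commute mult.left_commute has_sum_unique)
qed

text \<open>\<open>\<rho>\<close> is the Gram matrix of the rows of \<open>U\<close> weighted with
  \<open>sqrt (l k)\<close>, so this is Cauchy-Schwarz. For a summable diagonal it makes the entries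
  of \<open>\<rho>\<close> square-summable over \<open>I \<times> I\<close>.\<close>

lemma diagonalises_entry_bound:
  assumes D: "diagonalises I U l \<rho>" and i: "i \<in> I" and j: "j \<in> I"
  shows "(cmod (\<rho> i j))\<^sup>2 \<le> Re (\<rho> i i) * Re (\<rho> j j)"
proof -
  define x where "x i k = U i k * complex_of_real (sqrt (l k))" for i k
  have l: "0 \<le> l k" if "k \<in> I" for k using D that by (simp add: diagonalises_def)
  have x: "((\<lambda>k. (cmod (x i k))\<^sup>2) has_sum Re (\<rho> i i)) I" if "i \<in> I" for i
    using diagonalises_diagonal[OF D that]
    by (rule has_sum_cong[THEN iffD1, rotated])
      (simp add: x_def norm_mult power_mult_distrib l)
  have "((\<lambda>k. U i k * complex_of_real (l k) * cnj (U j k)) has_sum \<rho> i j) I"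
    using D i j by (simp add: diagonalises_def)
  hence "((\<lambda>k. x i k * cnj (x j k)) has_sum \<rho> i j) I"
  proof (rule has_sum_cong[THEN iffD1, rotated])
    fix k assume "k \<in> I"
    hence "complex_of_real (l k) = complex_of_real (sqrt (l k)) * complex_of_real (sqrt (l k))"
      using l by (simp flip: of_real_mult)
    then show "U i k * complex_of_real (l k) * cnj (U j k) = x i k * cnj (x j k)"
      by (simp add: x_def)
  qed
  hence "cmod (\<rho> i j) \<le> sqrt (Re (\<rho> i i)) * sqrt (Re (\<rho> j j))"
    using Cauchy_Schwarz_infsum[of "x i" I "\<lambda>k. cnj (x j k)"] x[OF i] x[OF j]
    by (simp add: square_summable_on_def norm_sq_def has_sum_iff)
  from power_mono[OF this, of 2] show ?thesis
    using has_sum_nonneg[OF x[OF i]] has_sum_nonneg[OF x[OF j]] by (simp add: power_mult_distrib)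
qed

lemma square_summable_Times:
  assumes "x square_summable_on I" "y square_summable_on J"
  shows "(\<lambda>p. x (fst p) * y (snd p)) square_summable_on I \<times> J"
  using has_sum_imp_summable[OF has_sum_Times_mult_real[OF has_sum_infsum has_sum_infsum]] assms
  unfolding square_summable_on_def norm_mult power_mult_distrib by blast

lemma unitary_op_column:
  assumes "unitary_op I T" "j \<in> I"
  shows "(\<lambda>i. T i j) square_summable_on I" "norm_sq I (\<lambda>i. T i j) = 1"
  using unitary_op_row[OF unitary_op_adjoint[OF assms(1)] assms(2)]
  by (simp_all add: adjoint_op_def[abs_def])

text \<open>With the spectral sum substituted for \<open>\<rho> a b\<close>, summing over
  \<open>b\<close> first leaves only the term \<open>k\<close>, by orthonormality of the columns.
  The exchange is legitimate because the sum over \<open>b\<close> of the moduli is at most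
  \<open>l i\<close>, and the eigenvalues are summable.\<close>

lemma diagonalises_eigenvector:
  assumes D: "diagonalises I U l \<rho>" and tr: "(\<lambda>i. Re (\<rho> i i)) summable_on I"
    and a: "a \<in> I" and k: "k \<in> I"
  shows "((\<lambda>b. \<rho> a b * U b k) has_sum U a k * complex_of_real (l k)) I"
proof -
  let ?g = "\<lambda>(b, i). U a i * complex_of_real (l i) * cnj (U b i) * U b k"
  have U: "unitary_op I U" and l: "\<And>k. k \<in> I \<Longrightarrow> 0 \<le> l k"
    using D by (auto simp: diagonalises_def)
  have l_summable: "l summable_on I"
    by (rule has_sum_imp_summable[OF diagonalises_trace[OF D has_sum_infsum[OF tr]]])
  have inner: "((\<lambda>b. ?g (b, i)) has_sum U a i * complex_of_real (l i) * id_op i k) I" if "i \<in> I" for i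
  proof -
    have "((\<lambda>b. cnj (U b i) * U b k) has_sum id_op i k) I"
      using U that k by (simp add: unitary_op_def)
    from has_sum_cmult_right[OF this, of "U a i * complex_of_real (l i)"]
    show ?thesis by (simp add: mult.assoc)
  qed
  have "(\<lambda>p. cmod (?g (prod.swap p))) summable_on I \<times> I"
  proof (rule norm_summable_on_Times)
    fix i assume i: "i \<in> I"
    show "((\<lambda>b. cmod (?g (prod.swap (i, b)))) has_sum (\<Sum>\<^sub>\<infinity>b\<in>I. cmod (?g (b, i)))) I"
      using inner[OF i] by (simp add: has_sum_iff summable_on_iff_abs_summable_on_complex)
  next
    show "(\<lambda>i. \<Sum>\<^sub>\<infinity>b\<in>I. cmod (?g (b, i))) summable_on I"
    proof (rule summable_on_comparison_test[OF l_summable])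
      fix i assume i: "i \<in> I"
      have "(\<Sum>\<^sub>\<infinity>b\<in>I. cmod (?g (b, i))) = cmod (U a i) * l i * (\<Sum>\<^sub>\<infinity>b\<in>I. cmod (U b i) * cmod (U b k))"
        using l[OF i] by (simp add: norm_mult mult.assoc infsum_cmult_right')
      \<comment> \<open>Cauchy-Schwarz for the moduli of two unit columns, which are viewed as
        complex vectors to match \<open>Cauchy_Schwarz_infsum\<close>.\<close>
      also have "(\<Sum>\<^sub>\<infinity>b\<in>I. cmod (U b i) * cmod (U b k)) \<le> 1"
      proof -
        have "cmod (\<Sum>\<^sub>\<infinity>b\<in>I. complex_of_real (cmod (U b i)) * complex_of_real (cmod (U b k))) \<le> sqrt 1 * sqrt 1"
          using Cauchy_Schwarz_infsum[of "\<lambda>b. complex_of_real (cmod (U b i))" I "\<lambda>b. complex_of_real (cmod (U b k))"]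
            unitary_op_column[OF U i] unitary_op_column[OF U k]
          by (simp add: square_summable_on_def norm_sq_def)
        moreover have "(\<Sum>\<^sub>\<infinity>b\<in>I. complex_of_real (cmod (U b i)) * complex_of_real (cmod (U b k)))
            = complex_of_real (\<Sum>\<^sub>\<infinity>b\<in>I. cmod (U b i) * cmod (U b k))"
          using Cauchy_Schwarz_abs_summable[OF unitary_op_column(1)[OF U i] unitary_op_column(1)[OF U k]]
          by (intro infsumI) (simp add: norm_mult has_sum_of_real_iff flip: of_real_mult)
        moreover have "0 \<le> (\<Sum>\<^sub>\<infinity>b\<in>I. cmod (U b i) * cmod (U b k))"
          by (intro infsum_nonneg) simp
        ultimately show ?thesis by simp
      qed
      also have "cmod (U a i) * l i * 1 \<le> 1 * l i * 1"
      proof -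
        have "(\<Sum>j\<in>{i}. (cmod (U a j))\<^sup>2) \<le> norm_sq I (U a)"
          unfolding norm_sq_def
          by (rule finite_sum_le_infsum)
            (use unitary_op_row[OF U a] i in \<open>auto simp: square_summable_on_def\<close>)
        hence "(cmod (U a i))\<^sup>2 \<le> 1" using unitary_op_row[OF U a] by simp
        hence "cmod (U a i) \<le> 1" by (simp add: abs_square_le_1)
        then show ?thesis using l[OF i] by (simp add: mult_left_le_one_le)
      qed
      finally show "(\<Sum>\<^sub>\<infinity>b\<in>I. cmod (?g (b, i))) \<le> l i"
        using l[OF i] by (simp add: mult_left_mono)
    qed (auto intro!: infsum_nonneg)
  qed
  hence "(\<lambda>p. ?g (prod.swap p)) summable_on I \<times> I"
    by (rule abs_summable_summable)
  hence sw: "(\<lambda>(i, b). ?g (b, i)) summable_on I \<times> I"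
    by (simp add: case_prod_unfold)
  have "((\<lambda>i. U a i * complex_of_real (l i) * id_op i k) has_sum U a k * complex_of_real (l k)) I"
    by (rule has_sum_finite_neutralI[of "{k}"]) (use k in \<open>auto simp: id_op_def\<close>)
  hence "((\<lambda>(i, b). ?g (b, i)) has_sum U a k * complex_of_real (l k)) (I \<times> I)"
    by (rule has_sum_SigmaI[rotated]) (use inner sw in auto)
  hence "(?g has_sum U a k * complex_of_real (l k)) (I \<times> I)"
    by (subst has_sum_swap) (simp add: case_prod_unfold)
  then show ?thesis
  proof (rule has_sum_SigmaD)
    fix b assume b: "b \<in> I"
    have "((\<lambda>i. U a i * complex_of_real (l i) * cnj (U b i)) has_sum \<rho> a b) I"
      using D a b by (simp add: diagonalises_def)
    from has_sum_cmult_left[OF this, of "U b k"]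
    show "((\<lambda>i. ?g (b, i)) has_sum \<rho> a b * U b k) I" by simp
  qed
qed

text \<open>The matrix element of \<open>\<rho>\<close> between column \<open>k\<close> of
  \<open>U\<close> and column \<open>j\<close> of \<open>V\<close> is \<open>w * m j\<close> when
  \<open>\<rho>\<close> acts to the right and \<open>l k * w\<close> when it acts to the left.
  Square-summability of the entries of \<open>\<rho>\<close> makes the double sum converge, so both
  orders give the same value.\<close>

lemma diagonalises_overlap:
  assumes DU: "diagonalises I U l \<rho>" and DV: "diagonalises I V m \<rho>"
    and tr: "(\<lambda>i. Re (\<rho> i i)) summable_on I" and k: "k \<in> I" and j: "j \<in> I"
    and W: "((\<lambda>i. cnj (U i k) * V i j) has_sum w) I"
  shows "w = 0 \<or> l k = m j"
proof -
  let ?g = "\<lambda>(a, b). cnj (U a k) * \<rho> a b * V b j"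
  have UU: "unitary_op I U" and VV: "unitary_op I V"
    using DU DV by (auto simp: diagonalises_def)
  have "(\<lambda>p. \<rho> (fst p) (snd p)) square_summable_on I \<times> I"
    unfolding square_summable_on_def
  proof (rule summable_on_comparison_test)
    show "(\<lambda>p. Re (\<rho> (fst p) (fst p)) * Re (\<rho> (snd p) (snd p))) summable_on I \<times> I"
      by (rule has_sum_imp_summable[OF has_sum_Times_mult_real[OF has_sum_infsum[OF tr] has_sum_infsum[OF tr]]])
  qed (use diagonalises_entry_bound[OF DU] in auto)
  moreover have "(\<lambda>p. cnj (U (fst p) k) * V (snd p) j) square_summable_on I \<times> I"
    using square_summable_Times[of "\<lambda>i. cnj (U i k)" I "\<lambda>i. V i j" I]
      unitary_op_column[OF UU k] unitary_op_column[OF VV j] by simp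
  ultimately have "(\<lambda>p. \<rho> (fst p) (snd p) * (cnj (U (fst p) k) * V (snd p) j)) summable_on I \<times> I"
    by (rule Cauchy_Schwarz_summable)
  hence "?g summable_on I \<times> I"
    by (simp add: case_prod_unfold ac_simps)
  then obtain S where S: "(?g has_sum S) (I \<times> I)"
    using has_sum_infsum by blast
  have "((\<lambda>a. cnj (U a k) * (V a j * complex_of_real (m j))) has_sum S) I"
  proof (rule has_sum_SigmaD[OF S])
    fix a assume "a \<in> I"
    from has_sum_cmult_right[OF diagonalises_eigenvector[OF DV tr this j], of "cnj (U a k)"]
    show "((\<lambda>b. ?g (a, b)) has_sum cnj (U a k) * (V a j * complex_of_real (m j))) I"
      by (simp add: mult.assoc)
  qed
  moreover have "((\<lambda>a. cnj (U a k) * (V a j * complex_of_real (m j))) has_sum w * complex_of_real (m j)) I"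
    using has_sum_cmult_left[OF W, of "complex_of_real (m j)"] by (simp add: mult.assoc)
  ultimately have 1: "S = w * complex_of_real (m j)" by (rule has_sum_unique)
  have "((\<lambda>(b, a). ?g (a, b)) has_sum S) (I \<times> I)"
    using S by (subst has_sum_swap) (simp add: case_prod_unfold)
  hence "((\<lambda>b. cnj (U b k) * complex_of_real (l k) * V b j) has_sum S) I"
  proof (rule has_sum_SigmaD)
    fix b assume b: "b \<in> I"
    have "((\<lambda>a. cnj (\<rho> b a * U a k)) has_sum cnj (U b k * complex_of_real (l k))) I"
      unfolding has_sum_cnj_iff by (rule diagonalises_eigenvector[OF DU tr b k])
    also have "?this \<longleftrightarrow> ((\<lambda>a. cnj (U a k) * \<rho> a b) has_sum cnj (U b k) * complex_of_real (l k)) I"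
      using diagonalises_hermitian[OF DU b] by (auto intro!: has_sum_cong)
    finally have "((\<lambda>a. cnj (U a k) * \<rho> a b) has_sum cnj (U b k) * complex_of_real (l k)) I" .
    from has_sum_cmult_left[OF this, of "V b j"]
    show "((\<lambda>a. case (b, a) of (b, a) \<Rightarrow> ?g (a, b)) has_sum cnj (U b k) * complex_of_real (l k) * V b j) I"
      by simp
  qed
  moreover have "((\<lambda>b. cnj (U b k) * complex_of_real (l k) * V b j) has_sum complex_of_real (l k) * w) I"
    using has_sum_cmult_right[OF W, of "complex_of_real (l k)"] by (simp add: ac_simps)
  ultimately have "S = complex_of_real (l k) * w" by (rule has_sum_unique)
  with 1 show ?thesis by simp
qed

text \<open>The squared overlaps of two eigenbases form a doubly stochastic matrix that only connects
  equal eigenvalues.\<close>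

lemma diagonalises_sum_unique:
  fixes f :: "real \<Rightarrow> real"
  assumes DU: "diagonalises I U l \<rho>" and DV: "diagonalises I V m \<rho>"
    and tr: "(\<lambda>i. Re (\<rho> i i)) summable_on I"
    and h: "((\<lambda>k. f (l k)) has_sum h) I"
  shows "((\<lambda>k. f (m k)) has_sum h) I"
proof -
  have UU: "unitary_op I U" and VV: "unitary_op I V"
    using DU DV by (auto simp: diagonalises_def)
  define col where "col T k = (\<lambda>i. if i \<in> I then T i k else 0)" for T :: "'a operator" and k
  define w where "w k j = op_apply I (adjoint_op U) (col V j) k" for k j
  have col: "l2_on I (col T k)" "norm_sq I (col T k) = 1" if "unitary_op I T" "k \<in> I" for T k
    using unitary_op_column[OF that] unfolding l2_on_def square_summable_on_def norm_sq_def col_def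
    by (auto cong: summable_on_cong infsum_cong)
  have sq: "((\<lambda>k. (cmod (w k j))\<^sup>2) has_sum 1) I" if j: "j \<in> I" for j
    using norm_sq_op_apply[OF unitary_op_adjoint[OF UU] col(1)[OF VV j]]
      l2_on_op_apply[OF unitary_op_adjoint[OF UU] col(1)[OF VV j]] col(2)[OF VV j]
    by (simp add: norm_sq_def w_def l2_on_def square_summable_on_def has_sum_iff)
  have w: "((\<lambda>i. cnj (U i k) * V i j) has_sum w k j) I" if "k \<in> I" "j \<in> I" for k j
    using op_apply_has_sum[OF unitary_op_adjoint[OF UU] col(1)[OF VV that(2)] that(1)]
    unfolding w_def
    by (rule has_sum_cong[THEN iffD1, rotated]) (simp add: col_def adjoint_op_def)
  \<comment> \<open>The product of the adjoint of \<open>V\<close> with \<open>U\<close> is the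
    adjoint of the matrix \<open>w\<close>, so the rows of \<open>w\<close> are unit vectors for the
    same reason as its columns.\<close>
  have w': "op_apply I (adjoint_op V) (col U k) j = cnj (w k j)" if "k \<in> I" "j \<in> I" for k j
    using that by (simp add: w_def op_apply_def col_def adjoint_op_def mult.commute
        flip: infsum_cnj cong: infsum_cong)
  have sq': "((\<lambda>j. (cmod (w k j))\<^sup>2) has_sum 1) I" if k: "k \<in> I" for k
  proof -
    have "((\<lambda>j. (cmod (op_apply I (adjoint_op V) (col U k) j))\<^sup>2) has_sum 1) I"
      using norm_sq_op_apply[OF unitary_op_adjoint[OF VV] col(1)[OF UU k]]
        l2_on_op_apply[OF unitary_op_adjoint[OF VV] col(1)[OF UU k]] col(2)[OF UU k]
      by (simp add: norm_sq_def l2_on_def square_summable_on_def has_sum_iff)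
    then show ?thesis by (simp add: w' k cong: has_sum_cong)
  qed
  \<comment> \<open>Summed over \<open>j\<close> this array gives \<open>f (l k)\<close>. Summed
    over \<open>k\<close> it gives \<open>f (m j)\<close>, because \<open>l k\<close> may be
    replaced by \<open>m j\<close> wherever \<open>w k j\<close> is nonzero.\<close>
  let ?g = "\<lambda>(k, j). (cmod (w k j))\<^sup>2 * f (l k)"
  have "(\<lambda>p. norm (?g p)) summable_on I \<times> I"
  proof (rule norm_summable_on_Times)
    show "((\<lambda>j. norm (?g (k, j))) has_sum \<bar>f (l k)\<bar>) I" if "k \<in> I" for k
      using has_sum_cmult_left[OF sq'[OF that], of "\<bar>f (l k)\<bar>"] by (simp add: abs_mult)
    show "(\<lambda>k. \<bar>f (l k)\<bar>) summable_on I"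
      using summable_on_iff_abs_summable_on_real[THEN iffD1, OF has_sum_imp_summable[OF h]] by simp
  qed
  hence "?g summable_on I \<times> I" by (rule abs_summable_summable)
  hence "(?g has_sum h) (I \<times> I)"
  proof (intro has_sum_SigmaI[OF _ h])
    show "((\<lambda>j. ?g (k, j)) has_sum f (l k)) I" if "k \<in> I" for k
      using has_sum_cmult_left[OF sq'[OF that], of "f (l k)"] by simp
  qed
  hence "((\<lambda>(j, k). (cmod (w k j))\<^sup>2 * f (l k)) has_sum h) (I \<times> I)"
    by (subst has_sum_swap) (simp add: case_prod_unfold)
  then show ?thesis
  proof (rule has_sum_SigmaD)
    fix j assume j: "j \<in> I"
    have "((\<lambda>k. (cmod (w k j))\<^sup>2 * f (m j)) has_sum f (m j)) I"
      using has_sum_cmult_left[OF sq[OF j], of "f (m j)"] by simp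
    then show "((\<lambda>k. case (j, k) of (j, k) \<Rightarrow> (cmod (w k j))\<^sup>2 * f (l k)) has_sum f (m j)) I"
      by (rule has_sum_cong[THEN iffD1, rotated])
        (use diagonalises_overlap[OF DU DV tr _ j w[OF _ j]] in fastforce)
  qed
qed

section \<open>Entropy values\<close>

lemma has_entropy_iff:
  "has_entropy I \<rho> h \<longleftrightarrow>
     (\<exists>U l. diagonalises I U l \<rho> \<and> ((\<lambda>k. - (l k * log 2 (l k))) has_sum h) I)"
  by (simp add: has_entropy_def diagonalises_def conj_assoc)

lemma has_entropy_cong:
  assumes "has_entropy I \<rho> h" "\<And>i j. i \<in> I \<Longrightarrow> j \<in> I \<Longrightarrow> \<rho> i j = \<sigma> i j"
  shows "has_entropy I \<sigma> h"
proof -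
  obtain U l where D: "diagonalises I U l \<rho>" and h: "((\<lambda>k. - (l k * log 2 (l k))) has_sum h) I"
    using assms(1) unfolding has_entropy_iff by blast
  have "diagonalises I U l \<sigma>"
    using D assms(2) unfolding diagonalises_def by simp
  with h show ?thesis unfolding has_entropy_iff by blast
qed

lemma has_entropy_unique:
  assumes "has_entropy I \<rho> h" "has_entropy I \<rho> h'" "(\<lambda>i. Re (\<rho> i i)) summable_on I"
  shows "h = h'"
proof -
  obtain U l where l: "diagonalises I U l \<rho>" "((\<lambda>k. - (l k * log 2 (l k))) has_sum h) I"
    using assms(1) unfolding has_entropy_iff by blast
  obtain V m where m: "diagonalises I V m \<rho>" "((\<lambda>k. - (m k * log 2 (m k))) has_sum h') I"
    using assms(2) unfolding has_entropy_iff by blast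
  have "((\<lambda>k. - (m k * log 2 (m k))) has_sum h) I"
    using diagonalises_sum_unique[where f = "\<lambda>x. - (x * log 2 x)", OF l(1) m(1) assms(3) l(2)] .
  then show ?thesis using m(2) by (rule has_sum_unique)
qed

text \<open>Every eigenvalue \<open>l\<close> of \<open>\<sigma>\<close> becomes two eigenvalues
  \<open>l / 2\<close>, with product eigenvectors. Each contributes
  \<open>- (l log l) / 2 + l / 2\<close>, so the two together add to the entropy of
  \<open>\<sigma>\<close> exactly its trace, which is 1.\<close>

lemma has_entropy_maximally_mixed_bit:
  assumes h: "has_entropy E \<sigma> h" and tr: "((\<lambda>i. Re (\<sigma> i i)) has_sum 1) E"
    and \<rho>: "\<And>a a' e e'. a \<in> {0, 1} \<Longrightarrow> a' \<in> {0, 1} \<Longrightarrow> e \<in> E \<Longrightarrow> e' \<in> E \<Longrightarrow>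
      \<rho> (a, e) (a', e') = id_op a a' / 2 * \<sigma> e e'"
  shows "has_entropy ({0, 1 :: nat} \<times> E) \<rho> (h + 1)"
proof -
  obtain U l where D: "diagonalises E U l \<sigma>" and ent: "((\<lambda>k. - (l k * log 2 (l k))) has_sum h) E"
    using h by (auto simp: has_entropy_iff)
  let ?U = "tensor id_op U" and ?l = "\<lambda>p. l (snd p) / 2"
  have l: "(l has_sum 1) E" by (rule diagonalises_trace[OF D tr])
  have "diagonalises ({0, 1} \<times> E) ?U ?l \<rho>"
    unfolding diagonalises_def
  proof (intro conjI ballI)
    show "unitary_op ({0, 1} \<times> E) ?U"
      using D by (intro unitary_op_tensor unitary_op_id_op) (simp add: diagonalises_def)
    show "0 \<le> ?l p" if "p \<in> {0, 1} \<times> E" for p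
      using D that by (auto simp: diagonalises_def)
    fix p q assume pq: "p \<in> {0, 1 :: nat} \<times> E" "q \<in> {0, 1 :: nat} \<times> E"
    have "((\<lambda>b. id_op (fst p) b * cnj (id_op (fst q) b)) has_sum id_op (fst p) (fst q)) {0, 1}"
      using unitary_op_id_op[of "{0, 1 :: nat}"] pq unfolding unitary_op_def by (metis mem_Times_iff)
    hence "((\<lambda>b. id_op (fst p) b * cnj (id_op (fst q) b) / 2) has_sum id_op (fst p) (fst q) / 2) {0, 1}"
      by (rule has_sum_divide_const)
    moreover have "((\<lambda>k. U (snd p) k * complex_of_real (l k) * cnj (U (snd q) k)) has_sum \<sigma> (snd p) (snd q)) E"
      using D pq by (auto simp: diagonalises_def)
    ultimately have "((\<lambda>k. id_op (fst p) (fst k) * cnj (id_op (fst q) (fst k)) / 2 *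
        (U (snd p) (snd k) * complex_of_real (l (snd k)) * cnj (U (snd q) (snd k))))
        has_sum id_op (fst p) (fst q) / 2 * \<sigma> (snd p) (snd q)) ({0, 1} \<times> E)"
      by (rule has_sum_Times_mult_complex)
    moreover have "\<rho> p q = id_op (fst p) (fst q) / 2 * \<sigma> (snd p) (snd q)"
      using \<rho>[of "fst p" "fst q" "snd p" "snd q"] pq by auto
    moreover have "id_op (fst p) (fst k) * cnj (id_op (fst q) (fst k)) / 2 *
        (U (snd p) (snd k) * complex_of_real (l (snd k)) * cnj (U (snd q) (snd k)))
        = ?U p k * complex_of_real (?l k) * cnj (?U q k)" for k
      by (simp add: tensor_def)
    ultimately show "((\<lambda>k. ?U p k * complex_of_real (?l k) * cnj (?U q k)) has_sum \<rho> p q) ({0, 1} \<times> E)"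
      by (simp only:)
  qed
  moreover have "((\<lambda>p. - (?l p * log 2 (?l p))) has_sum (h + 1)) ({0, 1 :: nat} \<times> E)"
  proof -
    have "((\<lambda>k. - (l k * log 2 (l k)) / 2 + l k / 2) has_sum h / 2 + 1 / 2) E"
      by (intro has_sum_add has_sum_divide_const ent l)
    moreover have "((\<lambda>_. 1) has_sum 2) {0, 1 :: nat}"
      by (rule has_sum_finiteI) simp_all
    ultimately have "((\<lambda>p. 1 * (- (l (snd p) * log 2 (l (snd p))) / 2 + l (snd p) / 2))
        has_sum 2 * (h / 2 + 1 / 2)) ({0, 1 :: nat} \<times> E)"
      by (intro has_sum_Times_mult_real[where f = "\<lambda>_. 1"])
    also have "?this \<longleftrightarrow> ((\<lambda>p. - (?l p * log 2 (?l p))) has_sum 2 * (h / 2 + 1 / 2)) ({0, 1 :: nat} \<times> E)"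
    proof (rule has_sum_cong)
      show "1 * (- (l (snd p) * log 2 (l (snd p))) / 2 + l (snd p) / 2) = - (?l p * log 2 (?l p))"
        if "p \<in> {0, 1 :: nat} \<times> E" for p
      proof (cases "l (snd p) = 0")
        case False
        hence "0 < l (snd p)" using D that by (force simp: diagonalises_def)
        then show ?thesis by (simp add: log_divide field_simps)
      qed simp
    qed
    finally show ?thesis by (simp only: distrib_left) simp
  qed
  ultimately show ?thesis unfolding has_entropy_iff by blast
qed

section \<open>Self-testing\<close>

text \<open>Differences of the two projections of a binary measurement have this form. Unitarity
  makes the isometry results above available, and self-adjointness turns the inverse into the
  operator itself.\<close>

definition reflection_op :: "'i set \<Rightarrow> 'i operator \<Rightarrow> bool" where
  "reflection_op I T \<longleftrightarrow> unitary_op I T \<and> (\<forall>i\<in>I. \<forall>j\<in>I. T j i = cnj (T i j))"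

lemma has_sum_id_op_left: "i \<in> I \<Longrightarrow> ((\<lambda>k. id_op i k * f k) has_sum f i) I"
  by (rule has_sum_finite_neutralI[of "{i}"]) (auto simp: id_op_def)

lemma has_sum_id_op_right: "j \<in> I \<Longrightarrow> ((\<lambda>k. f k * id_op k j) has_sum f j) I"
  by (rule has_sum_finite_neutralI[of "{j}"]) (auto simp: id_op_def)

lemma reflection_opI:
  assumes herm: "\<And>i j. i \<in> I \<Longrightarrow> j \<in> I \<Longrightarrow> T j i = cnj (T i j)"
    and sq: "\<And>i j. i \<in> I \<Longrightarrow> j \<in> I \<Longrightarrow> ((\<lambda>k. T i k * T k j) has_sum id_op i j) I"
  shows "reflection_op I T"
proof -
  have "((\<lambda>k. T i k * cnj (T j k)) has_sum id_op i j) I" if "i \<in> I" "j \<in> I" for i j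
    using sq[OF that] by (rule has_sum_cong[THEN iffD1, rotated]) (use herm[OF that(2)] in simp)
  moreover have "((\<lambda>k. cnj (T k i) * T k j) has_sum id_op i j) I" if "i \<in> I" "j \<in> I" for i j
    using sq[OF that] by (rule has_sum_cong[THEN iffD1, rotated]) (use herm[OF _ that(1)] in simp)
  ultimately show ?thesis
    using herm unfolding reflection_op_def unitary_op_def by blast
qed

lemma reflection_op_hermitian:
  "reflection_op I T \<Longrightarrow> i \<in> I \<Longrightarrow> j \<in> I \<Longrightarrow> T j i = cnj (T i j)"
  unfolding reflection_op_def by blast

lemma reflection_op_id_op: "reflection_op I id_op"
  using unitary_op_id_op[of I] by (simp add: reflection_op_def id_op_def)

lemma reflection_op_tensor:
  assumes "reflection_op I S" "reflection_op J T"
  shows "reflection_op (I \<times> J) (tensor S T)"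
proof -
  have "tensor S T q p = cnj (tensor S T p q)" if "p \<in> I \<times> J" "q \<in> I \<times> J" for p q
  proof -
    have "S (fst q) (fst p) = cnj (S (fst p) (fst q))"
      by (rule reflection_op_hermitian[OF assms(1)]) (use that in auto)
    moreover have "T (snd q) (snd p) = cnj (T (snd p) (snd q))"
      by (rule reflection_op_hermitian[OF assms(2)]) (use that in auto)
    ultimately show ?thesis unfolding tensor_def by (simp only: complex_cnj_mult)
  qed
  then show ?thesis
    using assms unitary_op_tensor[of I S J T] unfolding reflection_op_def by blast
qed

lemma op_apply_adjoint_reflection:
  assumes "reflection_op I T"
  shows "op_apply I (adjoint_op T) = op_apply I T"
proof (intro ext)
  fix x i
  have "adjoint_op T i k = T i k" if "i \<in> I" "k \<in> I" for k
    unfolding adjoint_op_def using reflection_op_hermitian[OF assms that(2,1)] by (rule sym)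
  then show "op_apply I (adjoint_op T) x i = op_apply I T x i"
    by (simp add: op_apply_def cong: infsum_cong)
qed

lemma reflection_op_unitary: "reflection_op I T \<Longrightarrow> unitary_op I T"
  by (simp add: reflection_op_def)

lemma op_apply_reflection_involution:
  assumes "reflection_op I T" "l2_on I x"
  shows "op_apply I T (op_apply I T x) = x"
  using op_apply_adjoint_cancel[OF reflection_op_unitary[OF assms(1)] assms(2)]
  by (simp add: op_apply_adjoint_reflection assms(1))

lemma inner_on_reflection:
  assumes "reflection_op I T" "l2_on I x" "l2_on I y"
  shows "inner_on I (op_apply I T y) x = inner_on I y (op_apply I T x)"
  using inner_on_adjoint[OF reflection_op_unitary[OF assms(1)] assms(2,3)]
  by (simp add: op_apply_adjoint_reflection assms(1))

text \<open>Together with \<open>op_apply_tensor_right_left\<close> this shows that Alice's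
  operators commute with Bob's, as both orders give the same tensor product. In the matrix product a
  single intermediate index contributes.\<close>

lemma op_apply_tensor_left_right:
  assumes "unitary_op I S" "unitary_op J T" "l2_on (I \<times> J) x"
  shows "op_apply (I \<times> J) (tensor S id_op) (op_apply (I \<times> J) (tensor id_op T) x)
    = op_apply (I \<times> J) (tensor S T) x"
proof (rule op_apply_compose)
  fix p q assume "p \<in> I \<times> J" "q \<in> I \<times> J"
  then show "((\<lambda>k. tensor S id_op p k * tensor id_op T k q) has_sum tensor S T p q) (I \<times> J)"
    by (intro has_sum_finite_neutralI[of "{(fst q, snd p)}"]) (auto simp: tensor_def id_op_def)
qed (use assms in \<open>auto intro!: unitary_op_tensor unitary_op_id_op\<close>)

lemma op_apply_tensor_right_left:
  assumes "unitary_op I S" "unitary_op J T" "l2_on (I \<times> J) x"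
  shows "op_apply (I \<times> J) (tensor id_op T) (op_apply (I \<times> J) (tensor S id_op) x)
    = op_apply (I \<times> J) (tensor S T) x"
proof (rule op_apply_compose)
  fix p q assume "p \<in> I \<times> J" "q \<in> I \<times> J"
  then show "((\<lambda>k. tensor id_op T p k * tensor S id_op k q) has_sum tensor S T p q) (I \<times> J)"
    by (intro has_sum_finite_neutralI[of "{(fst p, snd q)}"]) (auto simp: tensor_def id_op_def)
qed (use assms in \<open>auto intro!: unitary_op_tensor unitary_op_id_op\<close>)

definition observable :: "(nat \<Rightarrow> 'i operator) \<Rightarrow> 'i operator" where
  "observable M i j = M 0 i j - M 1 i j"

lemma projective_measurement_effect:
  assumes "projective_measurement I M" "i \<in> I" "j \<in> I" "a \<in> {0, 1}"
  shows "M a i j = (id_op i j + (-1) ^ a * observable M i j) / 2"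
proof -
  have "M 0 i j + M 1 i j = id_op i j"
    using assms by (simp add: projective_measurement_def)
  then show ?thesis
    using assms(4) by (auto simp: observable_def field_simps)
qed

lemma reflection_op_observable:
  assumes M: "projective_measurement I M"
  shows "reflection_op I (observable M)"
proof (rule reflection_opI)
  have P: "projection I (M 0)" "projection I (M 1)"
    using M by (auto simp: projective_measurement_def)
  fix i j assume ij: "i \<in> I" "j \<in> I"
  have "M 0 j i = cnj (M 0 i j)" "M 1 j i = cnj (M 1 i j)"
    using P ij unfolding projection_def by blast+
  then show "observable M j i = cnj (observable M i j)"
    by (simp only: observable_def complex_cnj_diff)
  have sq: "((\<lambda>k. M 0 i k * M 0 k j) has_sum M 0 i j) I"
    using P ij unfolding projection_def by blast
  have R: "observable M i j = 2 * M 0 i j - id_op i j" if "i \<in> I" "j \<in> I" for i j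
    using projective_measurement_effect[OF M that, of 0] by (simp add: field_simps)
  \<comment> \<open>The four terms are those of \<open>(2 P - 1)\<^sup>2\<close> for the projection
    \<open>P = M 0\<close>, and \<open>P\<^sup>2 = P\<close> makes them add up to the
    identity.\<close>
  have "((\<lambda>k. 4 * (M 0 i k * M 0 k j) - 2 * (id_op i k * M 0 k j) - 2 * (M 0 i k * id_op k j)
      + id_op i k * id_op k j) has_sum (4 * M 0 i j - 2 * M 0 i j - 2 * M 0 i j + id_op i j)) I" (is "(_ has_sum ?t) I")
    using ij
    by (intro has_sum_add has_sum_diff has_sum_cmult_right has_sum_id_op_left has_sum_id_op_right sq)
  also have "?this \<longleftrightarrow> ((\<lambda>k. observable M i k * observable M k j) has_sum ?t) I"
    by (rule has_sum_cong) (simp add: R ij algebra_simps)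
  also have "?t = id_op i j"
    by simp
  finally show "((\<lambda>k. observable M i k * observable M k j) has_sum id_op i j) I" .
qed

text \<open>
  On \<open>\<psi>\<close> and \<open>\<phi>\<close> the observables act as on a singlet: the anticommutator of \<open>A0\<close> and \<open>A1\<close> is the
  scalar \<open>2 c\<close>, and conjugating by \<open>A0\<close> (or \<open>A1\<close>) has the same effect as conjugating by an observable
  of Bob, which commutes with Alice's. Comparing the two shows that the two inner products are \<open>c\<close>
  times each other.
\<close>

lemma selftest_decoupling:
  fixes c :: complex
  assumes A0: "reflection_op Q A0" and A1: "reflection_op Q A1"
    and B0: "reflection_op Q B0" and B1: "reflection_op Q B1"
    and comm: "\<And>A B x. A \<in> {A0, A1} \<Longrightarrow> B \<in> {B0, B1} \<Longrightarrow> l2_on Q x \<Longrightarrow>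
      op_apply Q B (op_apply Q A x) = op_apply Q A (op_apply Q B x)"
    and c: "c \<noteq> 0" "c\<^sup>2 \<noteq> 1" "c \<in> \<real>"
    and \<psi>: "l2_on Q \<psi>" "op_apply Q B0 \<psi> = op_apply Q A0 \<psi>"
      "op_apply Q B1 \<psi> = (\<lambda>q. 2 * c * op_apply Q A0 \<psi> q - op_apply Q A1 \<psi> q)"
    and \<phi>: "l2_on Q \<phi>" "op_apply Q B0 \<phi> = op_apply Q A0 \<phi>"
      "op_apply Q B1 \<phi> = (\<lambda>q. 2 * c * op_apply Q A0 \<phi> q - op_apply Q A1 \<phi> q)"
  shows "inner_on Q \<phi> (op_apply Q A0 \<psi>) = 0" "inner_on Q \<phi> (op_apply Q A1 \<psi>) = 0"
proof -
  define a0 where "a0 = op_apply Q A0"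
  define a1 where "a1 = op_apply Q A1"
  define b0 where "b0 = op_apply Q B0"
  define b1 where "b1 = op_apply Q B1"
  note defs = a0_def a1_def b0_def b1_def
  note refl = A0 A1 B0 B1
  have l2: "l2_on Q (a0 x)" "l2_on Q (a1 x)" "l2_on Q (b0 x)" "l2_on Q (b1 x)" if "l2_on Q x" for x
    unfolding defs by (intro l2_on_op_apply reflection_op_unitary refl that)+
  have l2_comb: "l2_on Q (\<lambda>q. d * x q - y q)" if "l2_on Q x" "l2_on Q y" for d x y
    by (intro l2_on_diff l2_on_cmult that)
  have lin: "t (\<lambda>q. d * x q - y q) = (\<lambda>q. d * t x q - t y q)"
    if xy: "l2_on Q x" "l2_on Q y" and t: "t \<in> {a0, a1, b0, b1}" for d x y t
  proof -
    obtain T where "t = op_apply Q T" "reflection_op Q T"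
      using t refl by (auto simp: defs)
    then show ?thesis
      using op_apply_diff[OF reflection_op_unitary l2_on_cmult[OF xy(1)] xy(2)]
      by (simp add: op_apply_cmult)
  qed
  have inv: "t (t x) = x" if "l2_on Q x" "t \<in> {a0, a1, b0, b1}" for x t
    using that op_apply_reflection_involution refl by (auto simp: defs)
  have sym: "inner_on Q (t y) x = inner_on Q y (t x)"
    if "l2_on Q x" "l2_on Q y" "t \<in> {a0, a1, b0, b1}" for x y t
    using that inner_on_reflection refl by (auto simp: defs)
  have comm': "b (a x) = a (b x)" if "l2_on Q x" "a \<in> {a0, a1}" "b \<in> {b0, b1}" for a b x
    using that comm by (auto simp: defs)
  note \<psi>' = \<psi>[folded defs] and \<phi>' = \<phi>[folded defs]

  \<comment> \<open>\<open>b1\<close> acts on \<open>\<psi>\<close> as \<open>2 c a0 - a1\<close>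
    and commutes with Alice's operators, so \<open>\<psi> = b1 (b1 \<psi>)\<close> is the square of
    \<open>2 c a0 - a1\<close> applied to \<open>\<psi>\<close>. Expanding the square, the two
    copies of \<open>\<psi>\<close> cancel, and division by \<open>2 c\<close> leaves the
    anticommutator.\<close>
  have anti: "a1 (a0 \<psi>) = (\<lambda>q. 2 * c * \<psi> q - a0 (a1 \<psi>) q)"
  proof
    fix q
    have "\<psi> = b1 (\<lambda>q. 2 * c * a0 \<psi> q - a1 \<psi> q)"
      using inv[of \<psi> b1] \<psi>' by simp
    also have "\<dots> = (\<lambda>q. 2 * c * a0 (b1 \<psi>) q - a1 (b1 \<psi>) q)"
      by (simp add: lin l2 \<psi>'(1) comm')
    finally have "\<psi> q = 2 * c * a0 (b1 \<psi>) q - a1 (b1 \<psi>) q" by (rule fun_cong)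
    also have "a0 (b1 \<psi>) = (\<lambda>q. 2 * c * \<psi> q - a0 (a1 \<psi>) q)"
      by (simp add: \<psi>' lin l2 inv)
    also have "a1 (b1 \<psi>) = (\<lambda>q. 2 * c * a1 (a0 \<psi>) q - \<psi> q)"
      by (simp add: \<psi>' lin l2 inv)
    finally have "2 * c * (2 * c * \<psi> q - a0 (a1 \<psi>) q - a1 (a0 \<psi>) q) = 0"
      by (simp add: algebra_simps)
    then show "a1 (a0 \<psi>) q = 2 * c * \<psi> q - a0 (a1 \<psi>) q"
      using c(1) by simp
  qed
  have inner_comb: "inner_on Q \<phi> (\<lambda>q. d * x q - y q) = d * inner_on Q \<phi> x - inner_on Q \<phi> y"
    if "l2_on Q x" "l2_on Q y" for d x y
    by (simp add: inner_on_diff inner_on_cmult l2_on_cmult \<phi>' that)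

  \<comment> \<open>Conjugation by \<open>b0\<close> does not change \<open>a1\<close>, while on
    \<open>\<phi>\<close> and \<open>\<psi>\<close> it can be traded for conjugation by
    \<open>a0\<close>. Hence \<open>a1\<close> has the same matrix element as
    \<open>a0 a1 a0\<close>, which acts on \<open>\<psi>\<close> as
    \<open>2 c a0 - a1\<close>.\<close>
  have "inner_on Q \<phi> (a1 \<psi>) = inner_on Q \<phi> (b0 (b0 (a1 \<psi>)))"
    by (simp add: inv l2 \<psi>')
  also have "\<dots> = inner_on Q (b0 \<phi>) (b0 (a1 \<psi>))"
    by (simp add: sym l2 \<psi>'(1) \<phi>'(1))
  also have "\<dots> = inner_on Q (a0 \<phi>) (a1 (a0 \<psi>))"
    by (simp add: comm' \<psi>' \<phi>')
  also have "\<dots> = inner_on Q \<phi> (a0 (a1 (a0 \<psi>)))"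
    by (simp add: sym l2 \<psi>'(1) \<phi>'(1))
  also have "a0 (a1 (a0 \<psi>)) = (\<lambda>q. 2 * c * a0 \<psi> q - a1 \<psi> q)"
    by (simp add: anti lin l2 inv \<psi>'(1))
  finally have 1: "inner_on Q \<phi> (a1 \<psi>) = c * inner_on Q \<phi> (a0 \<psi>)"
    by (simp add: inner_comb l2 \<psi>'(1))

  \<comment> \<open>Bob's counterpart of \<open>a1\<close>. It is symmetric because \<open>c\<close>
    is real, but unlike \<open>b0\<close> it is not known to be an involution.\<close>
  define b where "b x = (\<lambda>q. 2 * c * b0 x q - b1 x q)" for x
  have b_\<psi>: "a1 \<psi> = b \<psi>" and b_\<phi>: "a1 \<phi> = b \<phi>"
    by (simp_all add: b_def \<psi>' \<phi>')
  have l2_b: "l2_on Q (b x)" if "l2_on Q x" for x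
    unfolding b_def by (intro l2_comb l2 that)
  have comm_b: "b (a x) = a (b x)" if "l2_on Q x" "a \<in> {a0, a1}" for a x
    using that by (auto simp: b_def lin l2 comm')
  have sym_b: "inner_on Q (b \<phi>) x = inner_on Q \<phi> (b x)" if x: "l2_on Q x" for x
  proof -
    have "inner_on Q (b \<phi>) x = cnj (2 * c * inner_on Q x (b0 \<phi>) - inner_on Q x (b1 \<phi>))"
      unfolding b_def cnj_inner_on[of Q x, symmetric]
      by (simp add: inner_on_diff inner_on_cmult l2_on_cmult \<phi>'(1) l2 x)
    also have "\<dots> = 2 * c * inner_on Q (b0 \<phi>) x - inner_on Q (b1 \<phi>) x"
      using c(3) by (simp add: cnj_inner_on Reals_cnj_iff)
    also have "\<dots> = inner_on Q \<phi> (b x)"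
      unfolding b_def by (simp add: inner_comb l2 x sym \<phi>'(1))
    finally show ?thesis .
  qed
  \<comment> \<open>A substitute for the missing involution property: applying \<open>b\<close>
    twice fixes the particular vector \<open>a0 \<psi>\<close>, since each \<open>b\<close> can be
    carried past Alice's operators to \<open>\<psi>\<close> and traded for \<open>a1\<close>
    there.\<close>
  have "a0 \<psi> = a0 (a1 (a1 \<psi>))" by (simp add: inv \<psi>'(1))
  also have "\<dots> = a0 (a1 (b \<psi>))" by (simp add: b_\<psi>)
  also have "\<dots> = a0 (b (a1 \<psi>))" by (simp add: comm_b \<psi>'(1))
  also have "\<dots> = b (b (a0 \<psi>))" by (simp add: b_\<psi> comm_b l2_b \<psi>'(1))
  finally have "inner_on Q \<phi> (a0 \<psi>) = inner_on Q \<phi> (b (b (a0 \<psi>)))" by simp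
  also have "\<dots> = inner_on Q (b \<phi>) (b (a0 \<psi>))"
    by (simp add: sym_b l2_b l2 \<psi>'(1))
  also have "\<dots> = inner_on Q (a1 \<phi>) (a0 (a1 \<psi>))"
    by (simp add: comm_b \<psi>'(1) b_\<psi> b_\<phi>)
  also have "\<dots> = inner_on Q \<phi> (a1 (a0 (a1 \<psi>)))"
    by (simp add: sym l2 \<psi>'(1) \<phi>'(1))
  also have "a0 (a1 \<psi>) = (\<lambda>q. 2 * c * \<psi> q - a1 (a0 \<psi>) q)"
    by (simp add: anti)
  also have "a1 \<dots> = (\<lambda>q. 2 * c * a1 \<psi> q - a0 \<psi> q)"
    by (simp add: lin l2 inv \<psi>'(1))
  finally have 2: "inner_on Q \<phi> (a0 \<psi>) = c * inner_on Q \<phi> (a1 \<psi>)"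
    by (simp add: inner_comb l2 \<psi>'(1))
  have "(1 - c\<^sup>2) * inner_on Q \<phi> (a0 \<psi>) = 0"
    using 1 2 by (simp add: algebra_simps power2_eq_square)
  hence "inner_on Q \<phi> (a0 \<psi>) = 0" using c(2) by simp
  with 1 show "inner_on Q \<phi> (op_apply Q A0 \<psi>) = 0" "inner_on Q \<phi> (op_apply Q A1 \<psi>) = 0"
    by (simp_all add: a0_def a1_def)
qed

section \<open>Purified strategies\<close>

text \<open>An \<open>infsum\<close> without convergence is 0, so linearity of
  \<open>op_trace\<close> in \<open>T\<close> needs convergence of the row sums and of the outer
  sum. Here the value is carried along with both.\<close>

definition trace_value :: "'i set \<Rightarrow> 'i operator \<Rightarrow> 'i operator \<Rightarrow> complex \<Rightarrow> bool" where
  "trace_value I T \<rho> F \<longleftrightarrow>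
     (\<exists>g. (\<forall>i\<in>I. ((\<lambda>k. T i k * \<rho> k i) has_sum g i) I) \<and> (g has_sum F) I)"

lemma op_trace_eqI:
  assumes "trace_value I T \<rho> F"
  shows "op_trace I (op_mult I T \<rho>) = F"
proof -
  obtain g where g: "\<And>i. i \<in> I \<Longrightarrow> ((\<lambda>k. T i k * \<rho> k i) has_sum g i) I" "(g has_sum F) I"
    using assms unfolding trace_value_def by blast
  have "op_trace I (op_mult I T \<rho>) = (\<Sum>\<^sub>\<infinity>i\<in>I. g i)"
    unfolding op_trace_def op_mult_def by (rule infsum_cong, rule infsumI, rule g(1))
  with g(2) show ?thesis by (simp add: infsumI)
qed

lemma trace_value_add:
  assumes "trace_value I S \<rho> F" "trace_value I T \<rho> G"
  shows "trace_value I (\<lambda>i j. S i j + T i j) \<rho> (F + G)"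
proof -
  obtain f g where "\<And>i. i \<in> I \<Longrightarrow> ((\<lambda>k. S i k * \<rho> k i) has_sum f i) I" "(f has_sum F) I"
    "\<And>i. i \<in> I \<Longrightarrow> ((\<lambda>k. T i k * \<rho> k i) has_sum g i) I" "(g has_sum G) I"
    using assms unfolding trace_value_def by blast
  then show ?thesis
    unfolding trace_value_def
    by (intro exI[of _ "\<lambda>i. f i + g i"]) (auto simp: distrib_right intro!: has_sum_add)
qed

lemma trace_value_cmult:
  assumes "trace_value I T \<rho> F"
  shows "trace_value I (\<lambda>i j. c * T i j) \<rho> (c * F)"
proof -
  obtain g where "\<And>i. i \<in> I \<Longrightarrow> ((\<lambda>k. T i k * \<rho> k i) has_sum g i) I" "(g has_sum F) I"
    using assms unfolding trace_value_def by blast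
  then show ?thesis
    unfolding trace_value_def
    by (intro exI[of _ "\<lambda>i. c * g i"]) (auto simp: mult.assoc intro!: has_sum_cmult_right)
qed

lemma trace_value_cong:
  assumes "trace_value I S \<rho> F" "\<And>i j. i \<in> I \<Longrightarrow> j \<in> I \<Longrightarrow> S i j = T i j"
  shows "trace_value I T \<rho> F"
proof -
  obtain g where g: "\<And>i. i \<in> I \<Longrightarrow> ((\<lambda>k. S i k * \<rho> k i) has_sum g i) I" "(g has_sum F) I"
    using assms(1) unfolding trace_value_def by blast
  have "((\<lambda>k. T i k * \<rho> k i) has_sum g i) I" if "i \<in> I" for i
    using g(1)[OF that] by (rule has_sum_cong[THEN iffD1, rotated]) (use assms(2) that in simp)
  with g(2) show ?thesis unfolding trace_value_def by blast
qed

section \<open>Decomposition of a purification along Eve's basis\<close>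

locale purified_strategy =
  fixes IA :: "'i set" and IB :: "'j set" and E :: "'e set"
    and \<rho> :: "('i \<times> 'j) operator" and M :: "nat \<Rightarrow> nat \<Rightarrow> 'i operator"
    and N :: "nat \<Rightarrow> nat \<Rightarrow> 'j operator" and \<Psi> :: "('i \<times> 'j) \<times> 'e \<Rightarrow> complex"
  assumes strategy: "quantum_strategy IA IB \<rho> M N"
    and purification: "purification (IA \<times> IB) E \<Psi> \<rho>"
begin

abbreviation Q :: "('i \<times> 'j) set" where "Q \<equiv> IA \<times> IB"

text \<open>These vectors are not normalised: their squared norms add up to 1. The cut-off outside
  \<open>Q\<close> makes them vectors in the sense of \<open>l2_on\<close>.\<close>

definition slice :: "'e \<Rightarrow> 'i \<times> 'j \<Rightarrow> complex" where
  "slice e q = (if q \<in> Q then \<Psi> (q, e) else 0)"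

definition A :: "nat \<Rightarrow> 'i operator" where "A x = observable (\<lambda>a. M a x)"

definition B :: "nat \<Rightarrow> 'j operator" where "B y = observable (\<lambda>b. N b y)"

lemma reflection_A: "x \<in> {0, 1} \<Longrightarrow> reflection_op IA (A x)"
  using strategy unfolding A_def quantum_strategy_def by (blast intro: reflection_op_observable)

lemma reflection_B: "y \<in> {0, 1} \<Longrightarrow> reflection_op IB (B y)"
  using strategy unfolding B_def quantum_strategy_def by (blast intro: reflection_op_observable)

lemma M_eq: "a \<in> {0, 1} \<Longrightarrow> x \<in> {0, 1} \<Longrightarrow> i \<in> IA \<Longrightarrow> j \<in> IA \<Longrightarrow>
    M a x i j = (id_op i j + (-1) ^ a * A x i j) / 2"
  using strategy unfolding A_def quantum_strategy_def
  by (intro projective_measurement_effect[where M = "\<lambda>a. M a x"]) auto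

lemma N_eq: "b \<in> {0, 1} \<Longrightarrow> y \<in> {0, 1} \<Longrightarrow> i \<in> IB \<Longrightarrow> j \<in> IB \<Longrightarrow>
    N b y i j = (id_op i j + (-1) ^ b * B y i j) / 2"
  using strategy unfolding B_def quantum_strategy_def
  by (intro projective_measurement_effect[where M = "\<lambda>b. N b y"]) auto

lemma square_summable_\<Psi>: "\<Psi> square_summable_on Q \<times> E"
  using purification by (auto simp: purification_def square_summable_on_def has_sum_iff)

lemma square_summable_\<Psi>_left:
  assumes "e \<in> E"
  shows "(\<lambda>q. \<Psi> (q, e)) square_summable_on Q"
proof -
  have "(\<lambda>(e, q). (cmod (\<Psi> (q, e)))\<^sup>2) summable_on E \<times> Q"
    using square_summable_\<Psi> unfolding square_summable_on_def by (subst (asm) summable_on_swap) simp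
  then show ?thesis
    using assms unfolding square_summable_on_def by (rule summable_on_SigmaD1)
qed

lemma square_summable_\<Psi>_right:
  assumes "q \<in> Q"
  shows "(\<lambda>e. \<Psi> (q, e)) square_summable_on E"
proof -
  have "(\<lambda>(q, e). (cmod (\<Psi> (q, e)))\<^sup>2) summable_on Q \<times> E"
    using square_summable_\<Psi> unfolding square_summable_on_def by (simp add: case_prod_unfold)
  then show ?thesis
    using assms unfolding square_summable_on_def by (rule summable_on_SigmaD1)
qed

lemma l2_slice: "e \<in> E \<Longrightarrow> l2_on Q (slice e)"
  using square_summable_\<Psi>_left unfolding l2_on_def square_summable_on_def slice_def
  by (auto cong: summable_on_cong)

lemma norm_sq_slice: "norm_sq Q (slice e) = (\<Sum>\<^sub>\<infinity>q\<in>Q. (cmod (\<Psi> (q, e)))\<^sup>2)"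
  by (simp add: norm_sq_def slice_def cong: infsum_cong)

lemma norm_sq_slice_has_sum: "((\<lambda>e. norm_sq Q (slice e)) has_sum 1) E"
proof -
  have "((\<lambda>(e, q). (cmod (\<Psi> (q, e)))\<^sup>2) has_sum 1) (E \<times> Q)"
    using purification unfolding purification_def by (subst (asm) has_sum_swap) simp
  then show ?thesis
  proof (rule has_sum_SigmaD)
    fix e assume "e \<in> E"
    from square_summable_\<Psi>_left[OF this]
    show "((\<lambda>q. case (e, q) of (e, q) \<Rightarrow> (cmod (\<Psi> (q, e)))\<^sup>2) has_sum norm_sq Q (slice e)) Q"
      by (simp add: norm_sq_slice square_summable_on_def)
  qed
qed

lemma \<rho>_has_sum:
  assumes "k \<in> Q" "q \<in> Q"
  shows "((\<lambda>e. \<Psi> (k, e) * cnj (\<Psi> (q, e))) has_sum \<rho> k q) E"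
proof -
  have "(\<lambda>e. \<Psi> (k, e) * cnj (\<Psi> (q, e))) summable_on E"
    using assms by (intro Cauchy_Schwarz_summable) (simp_all add: square_summable_\<Psi>_right)
  moreover have "\<rho> k q = (\<Sum>\<^sub>\<infinity>e\<in>E. \<Psi> (k, e) * cnj (\<Psi> (q, e)))"
    using purification assms by (auto simp: purification_def trace_out_snd_def ketbra_def)
  ultimately show ?thesis by simp
qed

text \<open>The triple series over \<open>q\<close>, \<open>k\<close> and \<open>e\<close> is never
  summed at once. For fixed \<open>q\<close> the sums over \<open>k\<close> and \<open>e\<close> are
  exchanged, then those over \<open>q\<close> and \<open>e\<close>; each time the terms are products
  of two square-summable families.\<close>

lemma trace_value_unitary:
  assumes T: "unitary_op Q T"
  obtains F where "trace_value Q T \<rho> F"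
    "((\<lambda>e. inner_on Q (slice e) (op_apply Q T (slice e))) has_sum F) E"
proof -
  define h where "h q e = op_apply Q T (slice e) q * cnj (\<Psi> (q, e))" for q e
  have g: "\<exists>s. ((\<lambda>k. T q k * \<rho> k q) has_sum s) Q \<and> (h q has_sum s) E" if q: "q \<in> Q" for q
  proof -
    have "(\<lambda>p. T q (fst p) * cnj (\<Psi> (q, snd p))) square_summable_on Q \<times> E"
      using square_summable_Times[OF unitary_op_row(1)[OF T q], of "\<lambda>e. cnj (\<Psi> (q, e))" E]
        square_summable_\<Psi>_right[OF q] by simp
    from Cauchy_Schwarz_summable[OF this square_summable_\<Psi>]
    obtain s where "((\<lambda>p. T q (fst p) * cnj (\<Psi> (q, snd p)) * \<Psi> p) has_sum s) (Q \<times> E)"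
      using has_sum_infsum by blast
    hence s: "((\<lambda>(k, e). T q k * (\<Psi> (k, e) * cnj (\<Psi> (q, e)))) has_sum s) (Q \<times> E)"
      by (simp add: case_prod_unfold ac_simps)
    have "((\<lambda>k. T q k * \<rho> k q) has_sum s) Q"
    proof (rule has_sum_SigmaD[OF s])
      fix k assume "k \<in> Q"
      from has_sum_cmult_right[OF \<rho>_has_sum[OF this q], of "T q k"]
      show "((\<lambda>e. case (k, e) of (k, e) \<Rightarrow> T q k * (\<Psi> (k, e) * cnj (\<Psi> (q, e)))) has_sum T q k * \<rho> k q) E"
        by simp
    qed
    moreover have "((\<lambda>(e, k). T q k * (\<Psi> (k, e) * cnj (\<Psi> (q, e)))) has_sum s) (E \<times> Q)"
      using s by (subst (asm) has_sum_swap) simp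
    hence "(h q has_sum s) E"
    proof (rule has_sum_SigmaD)
      fix e assume e: "e \<in> E"
      have "((\<lambda>k. T q k * slice e k) has_sum op_apply Q T (slice e) q) Q"
        by (rule op_apply_has_sum[OF T l2_slice[OF e] q])
      from has_sum_cmult_left[OF this, of "cnj (\<Psi> (q, e))"]
      show "((\<lambda>k. case (e, k) of (e, k) \<Rightarrow> T q k * (\<Psi> (k, e) * cnj (\<Psi> (q, e)))) has_sum h q e) Q"
        unfolding h_def by (simp add: slice_def[of e] mult.assoc cong: has_sum_cong)
    qed
    ultimately show ?thesis by blast
  qed
  then obtain g where g: "\<And>q. q \<in> Q \<Longrightarrow> ((\<lambda>k. T q k * \<rho> k q) has_sum g q) Q"
    "\<And>q. q \<in> Q \<Longrightarrow> (h q has_sum g q) E"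
    by metis
  \<comment> \<open>A unitary preserves the norm of every slice, so the transformed slices are
    jointly square-summable as well.\<close>
  have "(\<lambda>(e, q). (cmod (op_apply Q T (slice e) q))\<^sup>2) summable_on E \<times> Q"
  proof (rule summable_on_SigmaI[where g = "\<lambda>e. norm_sq Q (slice e)"])
    fix e assume "e \<in> E"
    then show "((\<lambda>q. case (e, q) of (e, q) \<Rightarrow> (cmod (op_apply Q T (slice e) q))\<^sup>2)
        has_sum norm_sq Q (slice e)) Q"
      using l2_on_op_apply[OF T l2_slice] norm_sq_op_apply[OF T l2_slice]
      by (simp add: l2_on_def square_summable_on_def has_sum_iff norm_sq_def)
  qed (use norm_sq_slice_has_sum in \<open>auto simp: has_sum_iff\<close>)
  hence "(\<lambda>p. op_apply Q T (slice (snd p)) (fst p)) square_summable_on Q \<times> E"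
    unfolding square_summable_on_def by (subst (asm) summable_on_swap) (simp add: case_prod_unfold)
  hence "(\<lambda>p. op_apply Q T (slice (snd p)) (fst p) * cnj (\<Psi> p)) summable_on Q \<times> E"
    by (rule Cauchy_Schwarz_summable) (simp add: square_summable_\<Psi>)
  then obtain F where "((\<lambda>p. op_apply Q T (slice (snd p)) (fst p) * cnj (\<Psi> p)) has_sum F) (Q \<times> E)"
    using has_sum_infsum by blast
  hence F: "((\<lambda>(q, e). h q e) has_sum F) (Q \<times> E)"
    by (simp add: h_def case_prod_unfold)
  have "(g has_sum F) Q"
    by (rule has_sum_SigmaD[OF F]) (use g(2) in simp)
  moreover have "((\<lambda>(e, q). h q e) has_sum F) (E \<times> Q)"
    using F by (subst (asm) has_sum_swap) simp
  hence "((\<lambda>e. inner_on Q (slice e) (op_apply Q T (slice e))) has_sum F) E"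
  proof (rule has_sum_SigmaD)
    fix e assume "e \<in> E"
    from inner_on_has_sum[OF l2_slice[OF this] l2_on_op_apply[OF T l2_slice[OF this]]]
    show "((\<lambda>q. case (e, q) of (e, q) \<Rightarrow> h q e) has_sum inner_on Q (slice e) (op_apply Q T (slice e))) Q"
      by (simp add: h_def slice_def[of e] mult.commute cong: has_sum_cong)
  qed
  ultimately show ?thesis
    using g(1) by (intro that[of F]) (auto simp: trace_value_def)
qed

abbreviation apply_A :: "nat \<Rightarrow> ('i \<times> 'j \<Rightarrow> complex) \<Rightarrow> 'i \<times> 'j \<Rightarrow> complex" where
  "apply_A x \<equiv> op_apply Q (tensor (A x) id_op)"

abbreviation apply_B :: "nat \<Rightarrow> ('i \<times> 'j \<Rightarrow> complex) \<Rightarrow> 'i \<times> 'j \<Rightarrow> complex" where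
  "apply_B y \<equiv> op_apply Q (tensor id_op (B y))"

lemma reflection_tensor_A: "x \<in> {0, 1} \<Longrightarrow> reflection_op Q (tensor (A x) id_op)"
  by (intro reflection_op_tensor reflection_A reflection_op_id_op)

lemma reflection_tensor_B: "y \<in> {0, 1} \<Longrightarrow> reflection_op Q (tensor id_op (B y))"
  by (intro reflection_op_tensor reflection_B reflection_op_id_op)

text \<open>Each effect is half of the identity plus or minus the observable, so every probability
  is a combination of four traces. The signed sum over the outcomes keeps only the trace with both
  observables, which then splits into slices.\<close>

lemma correlator_has_sum:
  assumes x: "x \<in> {0, 1}" and y: "y \<in> {0, 1}"
  shows "((\<lambda>e. Re (inner_on Q (apply_A x (slice e)) (apply_B y (slice e))))
    has_sum correlator (generated_behaviour IA IB \<rho> M N) x y) E"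
proof -
  have UA: "unitary_op IA (A x)" and UB: "unitary_op IB (B y)"
    using reflection_A[OF x] reflection_B[OF y] by (auto simp: reflection_op_def)
  obtain F1 where F1: "trace_value Q (tensor id_op id_op) \<rho> F1"
    using trace_value_unitary[OF unitary_op_tensor[OF unitary_op_id_op unitary_op_id_op]] .
  obtain FA where FA: "trace_value Q (tensor (A x) id_op) \<rho> FA"
    using trace_value_unitary[OF unitary_op_tensor[OF UA unitary_op_id_op]] .
  obtain FB where FB: "trace_value Q (tensor id_op (B y)) \<rho> FB"
    using trace_value_unitary[OF unitary_op_tensor[OF unitary_op_id_op UB]] .
  obtain F where F: "trace_value Q (tensor (A x) (B y)) \<rho> F"
    "((\<lambda>e. inner_on Q (slice e) (op_apply Q (tensor (A x) (B y)) (slice e))) has_sum F) E"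
    using trace_value_unitary[OF unitary_op_tensor[OF UA UB]] .
  have p: "generated_behaviour IA IB \<rho> M N a b x y
      = Re (F1 / 4 + (-1) ^ a / 4 * FA + (-1) ^ b / 4 * FB + (-1) ^ (a + b) / 4 * F)"
    if a: "a \<in> {0, 1}" and b: "b \<in> {0, 1}" for a b
  proof -
    have "trace_value Q (\<lambda>p q. 1 / 4 * tensor id_op id_op p q + (-1) ^ a / 4 * tensor (A x) id_op p q
        + (-1) ^ b / 4 * tensor id_op (B y) p q + (-1) ^ (a + b) / 4 * tensor (A x) (B y) p q) \<rho>
        (1 / 4 * F1 + (-1) ^ a / 4 * FA + (-1) ^ b / 4 * FB + (-1) ^ (a + b) / 4 * F)"
      by (intro trace_value_add trace_value_cmult F1 FA FB F(1))
    hence "trace_value Q (tensor (M a x) (N b y)) \<rho>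
        (1 / 4 * F1 + (-1) ^ a / 4 * FA + (-1) ^ b / 4 * FB + (-1) ^ (a + b) / 4 * F)"
    proof (rule trace_value_cong)
      fix p q assume "p \<in> Q" "q \<in> Q"
      then show "1 / 4 * tensor id_op id_op p q + (-1) ^ a / 4 * tensor (A x) id_op p q
        + (-1) ^ b / 4 * tensor id_op (B y) p q + (-1) ^ (a + b) / 4 * tensor (A x) (B y) p q
        = tensor (M a x) (N b y) p q"
        using a b x y by (auto simp: tensor_def M_eq N_eq field_simps power_add)
    qed
    from op_trace_eqI[OF this] show ?thesis
      by (simp add: generated_behaviour_def)
  qed
  have corr: "correlator (generated_behaviour IA IB \<rho> M N) x y = Re F"
    by (simp add: correlator_def p[simplified])
  have "inner_on Q (slice e) (op_apply Q (tensor (A x) (B y)) (slice e))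
      = inner_on Q (apply_A x (slice e)) (apply_B y (slice e))" if "e \<in> E" for e
    using inner_on_reflection[OF reflection_tensor_A[OF x] _ l2_slice[OF that], of "apply_B y (slice e)"]
      l2_on_op_apply[OF reflection_op_unitary[OF reflection_tensor_B[OF y]] l2_slice[OF that]]
    by (simp add: op_apply_tensor_left_right[OF UA UB l2_slice[OF that]])
  then show ?thesis
    unfolding corr using has_sum_Re[OF F(2)] by (simp only: cong: has_sum_cong)
qed

text \<open>Summed over \<open>e\<close>, the squared norm of \<open>(A_0 - B_0)\<close> on the
  slices is \<open>2 - 2 * 1\<close>, and that of \<open>(2 c A_0 - A_1 - B_1)\<close> is a
  combination of correlators that vanishes too. Nonnegative terms with sum 0 are all 0, which gives
  the relations slice by slice.\<close>

lemma selftest_relations: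
  assumes corr: "correlator (generated_behaviour IA IB \<rho> M N) 0 0 = 1"
      "correlator (generated_behaviour IA IB \<rho> M N) 0 1 = c"
      "correlator (generated_behaviour IA IB \<rho> M N) 1 0 = c"
      "correlator (generated_behaviour IA IB \<rho> M N) 1 1 = 2 * c\<^sup>2 - 1"
    and e: "e \<in> E"
  shows "apply_B 0 (slice e) = apply_A 0 (slice e)"
    and "apply_B 1 (slice e)
      = (\<lambda>q. 2 * complex_of_real c * apply_A 0 (slice e) q - apply_A 1 (slice e) q)"
proof -
  have l2_A: "l2_on Q (apply_A x (slice e))" if "x \<in> {0, 1}" "e \<in> E" for x e
    by (intro l2_on_op_apply reflection_op_unitary reflection_tensor_A l2_slice that)
  have l2_B: "l2_on Q (apply_B y (slice e))" if "y \<in> {0, 1}" "e \<in> E" for y e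
    by (intro l2_on_op_apply reflection_op_unitary reflection_tensor_B l2_slice that)
  have norm_A: "norm_sq Q (apply_A x (slice e)) = norm_sq Q (slice e)" if "x \<in> {0, 1}" "e \<in> E" for x e
    by (intro norm_sq_op_apply reflection_op_unitary reflection_tensor_A l2_slice that)
  have norm_B: "norm_sq Q (apply_B y (slice e)) = norm_sq Q (slice e)" if "y \<in> {0, 1}" "e \<in> E" for y e
    by (intro norm_sq_op_apply reflection_op_unitary reflection_tensor_B l2_slice that)
  have zero: "f e = 0"
    if "(f has_sum 0) E" "\<And>e. e \<in> E \<Longrightarrow> 0 \<le> f e" "e \<in> E" for f :: "'e \<Rightarrow> real" and e
    using nonneg_has_sum_le_0D[OF that(1) _ that(2,3)] by simp
  let ?a = "\<lambda>x e. apply_A x (slice e)" and ?b = "\<lambda>y e. apply_B y (slice e)"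

  have eq0: "?b 0 e = ?a 0 e" if e: "e \<in> E" for e
  proof -
    let ?f = "\<lambda>e. norm_sq Q (\<lambda>q. ?a 0 e q - ?b 0 e q)"
    have "((\<lambda>e. norm_sq Q (slice e) + norm_sq Q (slice e) - 2 * Re (inner_on Q (?a 0 e) (?b 0 e)))
        has_sum (1 + 1 - 2 * 1)) E"
      using correlator_has_sum[of 0 0] corr(1)
      by (intro has_sum_diff has_sum_add has_sum_cmult_right norm_sq_slice_has_sum) simp
    also have "?this \<longleftrightarrow> (?f has_sum (1 + 1 - 2 * 1)) E"
      by (rule has_sum_cong) (simp add: norm_sq_diff l2_A l2_B norm_A norm_B)
    finally have "?f e = 0"
      by (intro zero e) (simp_all add: norm_sq_nonneg)
    hence "(\<lambda>q. ?a 0 e q - ?b 0 e q) = (\<lambda>_. 0)"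
      by (simp add: norm_sq_eq_0_iff l2_on_diff l2_A l2_B e)
    then show ?thesis by (simp add: fun_eq_iff)
  qed
  then show "?b 0 e = ?a 0 e" using e .

  let ?z = "\<lambda>e q. 2 * complex_of_real c * ?a 0 e q - ?a 1 e q"
  let ?f = "\<lambda>e. norm_sq Q (\<lambda>q. ?z e q - ?b 1 e q)"
  let ?r = "\<lambda>x y e. Re (inner_on Q (?a x e) (?b y e))"
  have l2_z: "l2_on Q (?z e)" if "e \<in> E" for e
    by (intro l2_on_diff l2_on_cmult l2_A that) simp_all
  have expand: "?f e = (2 + 4 * c\<^sup>2) * norm_sq Q (slice e) - 4 * c * ?r 1 0 e - 4 * c * ?r 0 1 e + 2 * ?r 1 1 e"
    if e: "e \<in> E" for e
  proof -
    have "Re (inner_on Q (?z e) (?b 1 e)) = Re (inner_on Q (?b 1 e) (?z e))"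
      by (rule Re_inner_on_commute)
    also have "\<dots> = 2 * c * Re (inner_on Q (?b 1 e) (?a 0 e)) - Re (inner_on Q (?b 1 e) (?a 1 e))"
      by (simp add: inner_on_diff inner_on_cmult l2_on_cmult l2_A l2_B e mult.assoc)
    also have "\<dots> = 2 * c * ?r 0 1 e - ?r 1 1 e"
      by (simp only: Re_inner_on_commute[of Q "?b 1 e"])
    finally have 1: "Re (inner_on Q (?z e) (?b 1 e)) = 2 * c * ?r 0 1 e - ?r 1 1 e" .
    \<comment> \<open>The overlap of \<open>?a 0 e\<close> with \<open>?a 1 e\<close> is not a
      correlator, as both observables belong to Alice. The first relation turns it into the term
      \<open>?r 1 0 e\<close>, which is one.\<close>
    have "Re (inner_on Q (\<lambda>q. 2 * complex_of_real c * ?a 0 e q) (?a 1 e))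
        = Re (inner_on Q (?a 1 e) (\<lambda>q. 2 * complex_of_real c * ?a 0 e q))"
      by (rule Re_inner_on_commute)
    also have "\<dots> = 2 * c * ?r 1 0 e"
      by (simp add: inner_on_cmult eq0 e mult.assoc)
    finally have 2: "norm_sq Q (?z e) = (4 * c\<^sup>2 + 1) * norm_sq Q (slice e) - 4 * c * ?r 1 0 e"
      by (simp add: norm_sq_diff norm_sq_cmult l2_on_cmult l2_A e norm_A norm_mult
          power_mult_distrib distrib_right)
    have "?f e = norm_sq Q (?z e) + norm_sq Q (slice e) - 2 * Re (inner_on Q (?z e) (?b 1 e))"
      using norm_sq_diff[OF l2_z[OF e] l2_B[of 1, OF _ e]] norm_B[of 1, OF _ e] by simp
    then show ?thesis
      unfolding 1 2 by (simp add: algebra_simps)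
  qed
  have "((\<lambda>e. (2 + 4 * c\<^sup>2) * norm_sq Q (slice e) - 4 * c * ?r 1 0 e - 4 * c * ?r 0 1 e + 2 * ?r 1 1 e)
      has_sum ((2 + 4 * c\<^sup>2) * 1 - 4 * c * c - 4 * c * c + 2 * (2 * c\<^sup>2 - 1))) E"
    using correlator_has_sum[of 1 0] correlator_has_sum[of 0 1] correlator_has_sum[of 1 1] corr
    by (intro has_sum_diff has_sum_add has_sum_cmult_right norm_sq_slice_has_sum) simp_all
  also have "?this \<longleftrightarrow> (?f has_sum ((2 + 4 * c\<^sup>2) * 1 - 4 * c * c - 4 * c * c + 2 * (2 * c\<^sup>2 - 1))) E"
    by (rule has_sum_cong) (simp only: expand)
  also have "(2 + 4 * c\<^sup>2) * 1 - 4 * c * c - 4 * c * c + 2 * (2 * c\<^sup>2 - 1) = 0"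
    by (simp add: power2_eq_square)
  finally have "?f e = 0"
    by (intro zero e) (simp_all add: norm_sq_nonneg)
  hence "(\<lambda>q. ?z e q - ?b 1 e q) = (\<lambda>_. 0)"
    using norm_sq_eq_0_iff[OF l2_on_diff[OF l2_z[OF e] l2_B[of 1, OF _ e]]] by simp
  then show "?b 1 e = ?z e" by (simp add: fun_eq_iff)
qed

lemma inner_slice_decoupled:
  assumes corr: "correlator (generated_behaviour IA IB \<rho> M N) 0 0 = 1"
      "correlator (generated_behaviour IA IB \<rho> M N) 0 1 = c"
      "correlator (generated_behaviour IA IB \<rho> M N) 1 0 = c"
      "correlator (generated_behaviour IA IB \<rho> M N) 1 1 = 2 * c\<^sup>2 - 1"
    and c: "0 < c" "c < 1" and x: "x \<in> {0, 1}" and e: "e \<in> E" "e' \<in> E"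
  shows "inner_on Q (slice e') (apply_A x (slice e)) = 0"
proof -
  note rel = selftest_relations[OF corr]
  have comm: "apply_B y (apply_A x v) = apply_A x (apply_B y v)"
    if "x \<in> {0, 1}" "y \<in> {0, 1}" "l2_on Q v" for x y v
    using that reflection_A[of x] reflection_B[of y]
    by (simp only: op_apply_tensor_left_right op_apply_tensor_right_left reflection_op_unitary)
  have "c\<^sup>2 \<noteq> 1" using c by (simp add: power2_eq_1_iff)
  hence c': "complex_of_real c \<noteq> 0" "(complex_of_real c)\<^sup>2 \<noteq> 1" "complex_of_real c \<in> \<real>"
    using c by (simp_all flip: of_real_power)
  have "inner_on Q (slice e') (apply_A 0 (slice e)) = 0 \<and> inner_on Q (slice e') (apply_A 1 (slice e)) = 0"
    by (intro conjI selftest_decoupling[of Q "tensor (A 0) id_op" "tensor (A 1) id_op"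
          "tensor id_op (B 0)" "tensor id_op (B 1)" "complex_of_real c"]
        reflection_tensor_A reflection_tensor_B c' rel l2_slice e)
      (auto intro: comm)
  then show ?thesis using x by auto
qed

text \<open>\<open>e'\<close> stands first in the inner products because the entry carries the
  conjugate of \<open>\<Psi>\<close> at \<open>e'\<close>. The term with \<open>A x\<close> is all
  that distinguishes the two outcomes, and it is the one that \<open>inner_slice_decoupled\<close>
  removes.\<close>

lemma cq_state_entry:
  assumes a: "a \<in> {0, 1}" "a' \<in> {0, 1}" and x: "x \<in> {0, 1}" and e: "e \<in> E" "e' \<in> E"
  shows "cq_state IA IB E (\<lambda>a. M a x) \<Psi> (a, e) (a', e')
    = id_op a a' / 2 * (inner_on Q (slice e') (slice e)
        + (-1) ^ a * inner_on Q (slice e') (apply_A x (slice e)))"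
proof -
  have UA: "unitary_op Q (tensor (A x) id_op)"
    by (intro reflection_op_unitary reflection_tensor_A x)
  have inner: "op_mult (Q \<times> E) (tensor (tensor (M a x) id_op) id_op) (ketbra \<Psi>) (q, e) (q, e')
      = cnj (slice e' q) * (slice e q + (-1) ^ a * apply_A x (slice e) q) / 2" if q: "q \<in> Q" for q
  proof -
    have "((\<lambda>k. id_op q k * slice e k) has_sum slice e q) Q"
      by (rule has_sum_id_op_left[OF q])
    moreover have "((\<lambda>k. tensor (A x) id_op q k * slice e k) has_sum apply_A x (slice e) q) Q"
      by (rule op_apply_has_sum[OF UA l2_slice[OF e(1)] q])
    ultimately have "((\<lambda>k. (id_op q k * slice e k + (-1) ^ a * (tensor (A x) id_op q k * slice e k)) *
        (cnj (slice e' q) / 2)) has_sum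
        (slice e q + (-1) ^ a * apply_A x (slice e) q) * (cnj (slice e' q) / 2)) Q"
      by (intro has_sum_cmult_left has_sum_add has_sum_cmult_right)
    also have "?this \<longleftrightarrow> ((\<lambda>k. tensor (M a x) id_op q k * (\<Psi> (k, e) * cnj (\<Psi> (q, e')))) has_sum
        (slice e q + (-1) ^ a * apply_A x (slice e) q) * (cnj (slice e' q) / 2)) Q"
    proof (rule has_sum_cong)
      fix k assume k: "k \<in> Q"
      have T: "tensor (M a x) id_op q k = (id_op q k + (-1) ^ a * tensor (A x) id_op q k) / 2"
        using q k a x by (auto simp: tensor_def M_eq id_op_def prod_eq_iff)
      show "(id_op q k * slice e k + (-1) ^ a * (tensor (A x) id_op q k * slice e k)) *
          (cnj (slice e' q) / 2) = tensor (M a x) id_op q k * (\<Psi> (k, e) * cnj (\<Psi> (q, e')))"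
        using q k unfolding T by (simp add: slice_def field_simps)
    qed
    finally have "(\<Sum>\<^sub>\<infinity>k\<in>Q. tensor (M a x) id_op q k * (\<Psi> (k, e) * cnj (\<Psi> (q, e'))))
        = cnj (slice e' q) * (slice e q + (-1) ^ a * apply_A x (slice e) q) / 2"
      by (simp add: has_sum_iff mult.commute)
    \<comment> \<open>The identity on Eve's factor keeps only the indices with second component
      \<open>e\<close>, which reduces the sum over \<open>Q \<times> E\<close> to one over
      \<open>Q\<close>.\<close>
    moreover have "op_mult (Q \<times> E) (tensor (tensor (M a x) id_op) id_op) (ketbra \<Psi>) (q, e) (q, e')
        = (\<Sum>\<^sub>\<infinity>p\<in>(\<lambda>k. (k, e)) ` Q. tensor (M a x) id_op q (fst p) * (\<Psi> p * cnj (\<Psi> (q, e'))))"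
      unfolding op_mult_def
      by (rule infsum_cong_neutral) (use e in \<open>auto simp: tensor_def[of "tensor _ _"] ketbra_def id_op_def\<close>)
    moreover have "\<dots> = (\<Sum>\<^sub>\<infinity>k\<in>Q. tensor (M a x) id_op q k * (\<Psi> (k, e) * cnj (\<Psi> (q, e'))))"
      by (subst infsum_reindex) (auto simp: inj_on_def o_def)
    ultimately show ?thesis by simp
  qed
  have sum: "trace_out_fst Q (op_mult (Q \<times> E) (tensor (tensor (M a x) id_op) id_op) (ketbra \<Psi>)) e e'
      = (inner_on Q (slice e') (slice e) + (-1) ^ a * inner_on Q (slice e') (apply_A x (slice e))) / 2"
  proof -
    have "((\<lambda>q. cnj (slice e' q) * (slice e q + (-1) ^ a * apply_A x (slice e) q) / 2) has_sum
        (inner_on Q (slice e') (slice e) + (-1) ^ a * inner_on Q (slice e') (apply_A x (slice e))) / 2) Q"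
      using has_sum_divide_const[OF has_sum_add[OF
            inner_on_has_sum[OF l2_slice[OF e(2)] l2_slice[OF e(1)]]
            has_sum_cmult_right[OF inner_on_has_sum[OF l2_slice[OF e(2)] l2_on_op_apply[OF UA l2_slice[OF e(1)]]], of "(-1) ^ a"]], of 2]
      by (simp add: distrib_left mult.left_commute)
    then show ?thesis
      by (simp add: trace_out_fst_def inner infsumI cong: infsum_cong)
  qed
  show ?thesis
    using a sum by (auto simp: cq_state_def tensor_def[of "ketbra _"] ketbra_def ket_def id_op_def)
qed

end

section \<open>Two-qubit realisation and key rate\<close>

text \<open>The first claim provides a value, the second excludes all others. In the second,
  \<open>H(AE)\<close> comes from an arbitrary diagonalisation of \<open>\<rho>\<close> and is
  compared with the product one through \<open>has_entropy_unique\<close>.\<close>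

lemma
  fixes \<rho> :: "(nat \<times> 'e) operator"
  assumes tr: "((\<lambda>e. Re (\<sigma> e e)) has_sum 1) E"
    and \<rho>: "\<And>a a' e e'. a \<in> {0, 1} \<Longrightarrow> a' \<in> {0, 1} \<Longrightarrow> e \<in> E \<Longrightarrow> e' \<in> E \<Longrightarrow>
      \<rho> (a, e) (a', e') = id_op a a' / 2 * \<sigma> e e'"
  shows has_cond_entropy_decoupled: "has_entropy E \<sigma> k \<Longrightarrow> has_cond_entropy {0, 1} E \<rho> 1"
    and has_cond_entropy_decoupled_unique: "has_cond_entropy {0, 1} E \<rho> h \<Longrightarrow> h = 1"
proof -
  have out: "trace_out_fst {0, 1} \<rho> e e' = \<sigma> e e'" if "e \<in> E" "e' \<in> E" for e e'
  proof -
    have "trace_out_fst {0, 1} \<rho> e e' = \<rho> (0, e) (0, e') + \<rho> (1, e) (1, e')"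
      by (simp add: trace_out_fst_def)
    also have "\<dots> = id_op 0 (0 :: nat) / 2 * \<sigma> e e' + id_op 1 (1 :: nat) / 2 * \<sigma> e e'"
      using that by (intro arg_cong2[where f = "(+)"] \<rho>) simp_all
    also have "\<dots> = \<sigma> e e'"
      by (simp add: id_op_def)
    finally show ?thesis .
  qed
  show "has_cond_entropy {0, 1} E \<rho> 1" if k: "has_entropy E \<sigma> k"
  proof -
    have "has_entropy E (trace_out_fst {0, 1} \<rho>) k"
      by (rule has_entropy_cong[OF k], rule out[symmetric])
    moreover have "has_entropy ({0, 1} \<times> E) \<rho> (k + 1)"
      by (rule has_entropy_maximally_mixed_bit[OF k tr \<rho>])
    ultimately show ?thesis
      unfolding has_cond_entropy_def by (intro exI[of _ "k + 1"] exI[of _ k]) auto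
  qed
  show "h = 1" if cond: "has_cond_entropy {0, 1} E \<rho> h"
  proof -
    obtain hAE hE where hAE: "has_entropy ({0, 1} \<times> E) \<rho> hAE"
      and hE: "has_entropy E (trace_out_fst {0, 1} \<rho>) hE" and h: "h = hAE - hE"
      using cond unfolding has_cond_entropy_def by blast
    have "has_entropy E \<sigma> hE"
      by (rule has_entropy_cong[OF hE out])
    hence "has_entropy ({0, 1} \<times> E) \<rho> (hE + 1)"
      by (rule has_entropy_maximally_mixed_bit[OF _ tr \<rho>])
    moreover have "(\<lambda>p. Re (\<rho> p p)) summable_on {0, 1} \<times> E"
    proof -
      have "((\<lambda>_. 1 / 2 :: real) has_sum 1) {0, 1 :: nat}"
        by (rule has_sum_finiteI) simp_all
      from has_sum_imp_summable[OF has_sum_Times_mult_real[OF this tr]]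
      show ?thesis
      proof (rule summable_on_cong[THEN iffD1, rotated])
        fix p assume "p \<in> {0, 1 :: nat} \<times> E"
        hence "\<rho> (fst p, snd p) (fst p, snd p) = id_op (fst p) (fst p) / 2 * \<sigma> (snd p) (snd p)"
          by (intro \<rho>) auto
        then show "1 / 2 * Re (\<sigma> (snd p) (snd p)) = Re (\<rho> p p)"
          unfolding prod.collapse by (simp only:) (simp add: id_op_def)
      qed
    qed
    ultimately have "hAE = hE + 1"
      using hAE has_entropy_unique by blast
    with h show ?thesis by simp
  qed
qed

text \<open>Decoupling turns the classical-quantum state into a uniform bit next to Eve's reduced
  state \<open>\<sigma>\<close>, which consists of the overlaps of the slices. For a one-dimensional
  Eve \<open>\<sigma>\<close> is the number 1, of entropy 0; this case suffices to exhibit an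
  attained value, because the two-qubit state used for that is pure.\<close>

lemma (in purified_strategy)
  assumes corr: "correlator (generated_behaviour IA IB \<rho> M N) 0 0 = 1"
      "correlator (generated_behaviour IA IB \<rho> M N) 0 1 = c"
      "correlator (generated_behaviour IA IB \<rho> M N) 1 0 = c"
      "correlator (generated_behaviour IA IB \<rho> M N) 1 1 = 2 * c\<^sup>2 - 1"
    and c: "0 < c" "c < 1" and x: "x \<in> {0, 1}"
  shows cond_entropy_eq_1: "has_cond_entropy {0, 1} E (cq_state IA IB E (\<lambda>a. M a x) \<Psi>) h \<Longrightarrow> h = 1"
    and has_cond_entropy_trivial_Eve:
      "E = {e} \<Longrightarrow> has_cond_entropy {0, 1} E (cq_state IA IB E (\<lambda>a. M a x) \<Psi>) 1"
proof -
  define \<sigma> where "\<sigma> e e' = inner_on Q (slice e') (slice e)" for e e'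
  have \<sigma>_diag: "\<sigma> e e = complex_of_real (norm_sq Q (slice e))" if "e \<in> E" for e
    by (simp add: \<sigma>_def inner_on_self l2_slice that)
  have tr: "((\<lambda>e. Re (\<sigma> e e)) has_sum 1) E"
    using norm_sq_slice_has_sum by (simp add: \<sigma>_diag cong: has_sum_cong)
  have cq: "cq_state IA IB E (\<lambda>a. M a x) \<Psi> (a, e) (a', e') = id_op a a' / 2 * \<sigma> e e'"
    if "a \<in> {0, 1}" "a' \<in> {0, 1}" "e \<in> E" "e' \<in> E" for a a' e e'
    using cq_state_entry[OF that(1,2) x that(3,4)] inner_slice_decoupled[OF corr c x that(3,4)]
    by (simp add: \<sigma>_def)
  show "h = 1" if "has_cond_entropy {0, 1} E (cq_state IA IB E (\<lambda>a. M a x) \<Psi>) h"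
    using has_cond_entropy_decoupled_unique[OF tr cq that] .
  show "has_cond_entropy {0, 1} E (cq_state IA IB E (\<lambda>a. M a x) \<Psi>) 1" if E: "E = {e}"
  proof (rule has_cond_entropy_decoupled[OF tr cq])
    have "norm_sq Q (slice e) = 1"
      using norm_sq_slice_has_sum has_sum_finite[of "{e}" "\<lambda>e. norm_sq Q (slice e)"] has_sum_unique
      unfolding E by fastforce
    hence "\<sigma> e e = 1" using \<sigma>_diag E by simp
    hence "diagonalises E id_op (\<lambda>_. 1) \<sigma>"
      unfolding diagonalises_def
      using unitary_op_id_op[of E] by (auto simp: E id_op_def intro!: has_sum_finiteI)
    then show "has_entropy E \<sigma> 0"
      unfolding has_entropy_iff by (intro exI[of _ id_op] exI[of _ "\<lambda>_. 1"]) simp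
  qed
qed

section \<open>The two-qubit strategy\<close>

text \<open>The projections of the observable \<open>cos \<alpha> Z + sin \<alpha> X\<close>, with
  Pauli matrices \<open>Z\<close> and \<open>X\<close>. On the real Bell state below two such
  observables have correlator \<open>cos (\<alpha> - \<beta>)\<close>, so angles in the plane can be
  used directly and all matrices are real and symmetric.\<close>

definition qubit_effect :: "real \<Rightarrow> nat \<Rightarrow> nat operator" where
  "qubit_effect \<alpha> a i j = (id_op i j + (-1) ^ a *
     complex_of_real (if i \<noteq> j then sin \<alpha> else if i = 0 then cos \<alpha> else - cos \<alpha>)) / 2"

definition bell_state :: "nat \<times> nat \<Rightarrow> complex" where
  "bell_state q = (if fst q = snd q then complex_of_real (1 / sqrt 2) else 0)"

lemma projective_measurement_qubit_effect: "projective_measurement {0, 1} (qubit_effect \<alpha>)"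
proof -
  define S C where "S = complex_of_real (sin \<alpha>)" and "C = complex_of_real (cos \<alpha>)"
  have SC: "S * S + C * C = 1"
    unfolding S_def C_def using sin_cos_squared_add[of \<alpha>]
    by (simp add: power2_eq_square flip: of_real_mult of_real_add)
  have cnj: "cnj S = S" "cnj C = C" by (simp_all add: S_def C_def)
  have eff: "qubit_effect \<alpha> a 0 0 = (1 + (-1) ^ a * C) / 2" "qubit_effect \<alpha> a 1 1 = (1 - (-1) ^ a * C) / 2"
    "qubit_effect \<alpha> a 0 1 = (-1) ^ a * S / 2" "qubit_effect \<alpha> a 1 0 = (-1) ^ a * S / 2" for a
    by (simp_all add: qubit_effect_def id_op_def S_def C_def)
  have "projection {0, 1} (qubit_effect \<alpha> a)" if "a \<in> {0, 1}" for a
    unfolding projection_def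
  proof (intro conjI ballI has_sum_finiteI)
    fix i j :: nat assume ij: "i \<in> {0, 1}" "j \<in> {0, 1}"
    then show "qubit_effect \<alpha> a j i = cnj (qubit_effect \<alpha> a i j)"
      by (elim insertE emptyE) (simp_all only: eff, simp_all add: cnj)
    have sum: "(\<Sum>k\<in>{0, 1}. f k) = f 0 + f 1" for f :: "nat \<Rightarrow> complex"
      by simp
    define g :: complex where "g = (-1) ^ a"
    have g: "g * g = 1"
      by (simp add: g_def flip: power_add power_mult_distrib)
    have "(1 + g * C) * (1 + g * C) + g * S * (g * S) = 2 * (1 + g * C)"
      "(1 + g * C) * (g * S) + g * S * (1 - g * C) = 2 * (g * S)"
      "g * S * (1 + g * C) + (1 - g * C) * (g * S) = 2 * (g * S)"
      "g * S * (g * S) + (1 - g * C) * (1 - g * C) = 2 * (1 - g * C)"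
      using SC g by algebra+
    then show "qubit_effect \<alpha> a i j = (\<Sum>k\<in>{0, 1}. qubit_effect \<alpha> a i k * qubit_effect \<alpha> a k j)"
      unfolding sum using ij
      by (elim insertE emptyE)
        (simp_all only: eff g_def[symmetric] times_divide_times_eq add_divide_distrib[symmetric], simp_all)
  qed simp
  then show ?thesis
    unfolding projective_measurement_def by (auto simp: qubit_effect_def add_divide_distrib[symmetric])
qed

lemma density_operator_ketbra:
  assumes "((\<lambda>i. (cmod (\<psi> i))\<^sup>2) has_sum 1) I"
  shows "density_operator I (ketbra \<psi>)"
  unfolding density_operator_def
proof (intro conjI allI impI)
  fix F and v :: "'a \<Rightarrow> complex"
  have "(\<Sum>i\<in>F. \<Sum>j\<in>F. cnj (v i) * ketbra \<psi> i j * v j)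
      = (\<Sum>i\<in>F. cnj (v i) * \<psi> i) * cnj (\<Sum>i\<in>F. cnj (v i) * \<psi> i)"
    by (simp add: sum_product ketbra_def ac_simps)
  also have "\<dots> = complex_of_real ((cmod (\<Sum>i\<in>F. cnj (v i) * \<psi> i))\<^sup>2)"
    by (simp only: complex_norm_square)
  finally show "(\<Sum>i\<in>F. \<Sum>j\<in>F. cnj (v i) * ketbra \<psi> i j * v j) \<in> \<real>\<^sub>\<ge>\<^sub>0"
    by simp
next
  have "((\<lambda>i. complex_of_real ((cmod (\<psi> i))\<^sup>2)) has_sum complex_of_real 1) I"
    using assms by (simp only: has_sum_of_real_iff)
  then show "((\<lambda>i. ketbra \<psi> i i) has_sum 1) I"
    by (simp only: ketbra_def complex_norm_square of_real_1)
qed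

lemma bell_state_norm: "((\<lambda>q. (cmod (bell_state q))\<^sup>2) has_sum 1) ({0, 1} \<times> {0, 1})"
  by (rule has_sum_finiteI)
    (simp_all add: bell_state_def norm_divide power_divide flip: sum.cartesian_product')

definition qubit_behaviour :: "(nat \<Rightarrow> real) \<Rightarrow> (nat \<Rightarrow> real) \<Rightarrow> behaviour" where
  "qubit_behaviour \<alpha> \<beta> = generated_behaviour {0, 1} {0, 1} (ketbra bell_state)
     (\<lambda>a x. qubit_effect (\<alpha> x) a) (\<lambda>b y. qubit_effect (\<beta> y) b)"

lemma quantum_strategy_qubits:
  "quantum_strategy {0, 1} {0, 1} (ketbra bell_state)
    (\<lambda>a x. qubit_effect (\<alpha> x) a) (\<lambda>b y. qubit_effect (\<beta> y) b)"
  unfolding quantum_strategy_def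
  using density_operator_ketbra[OF bell_state_norm] projective_measurement_qubit_effect by simp

lemma qubit_behaviour_eq:
  assumes "a \<in> {0, 1}" "b \<in> {0, 1}"
  shows "qubit_behaviour \<alpha> \<beta> a b x y = (1 + (-1) ^ (a + b) * cos (\<alpha> x - \<beta> y)) / 4"
proof -
  have sq: "complex_of_real (sqrt 2) * complex_of_real (sqrt 2) = 2"
    by (simp flip: of_real_mult)
  \<comment> \<open>Only the index pairs \<open>(i, i)\<close> and \<open>(k, k)\<close> carry
    weight in the Bell state, which leaves half the sum of the entrywise products of the two
    matrices.\<close>
  have "op_trace ({0, 1} \<times> {0, 1}) (op_mult ({0, 1} \<times> {0, 1})
      (tensor (qubit_effect (\<alpha> x) a) (qubit_effect (\<beta> y) b)) (ketbra bell_state))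
    = (\<Sum>i\<in>{0, 1}. \<Sum>k\<in>{0, 1}. qubit_effect (\<alpha> x) a i k * qubit_effect (\<beta> y) b i k) / 2"
    by (simp add: op_trace_def op_mult_def tensor_def ketbra_def bell_state_def sq
        add_divide_distrib flip: sum.cartesian_product')
  also have "\<dots> = complex_of_real ((1 + (-1) ^ (a + b) * cos (\<alpha> x - \<beta> y)) / 4)"
    using assms by (auto simp: qubit_effect_def id_op_def cos_diff field_simps)
  finally show ?thesis
    by (simp only: qubit_behaviour_def generated_behaviour_def Re_complex_of_real)
qed

lemma correlator_qubit_behaviour: "correlator (qubit_behaviour \<alpha> \<beta>) x y = cos (\<alpha> x - \<beta> y)"
  by (simp add: correlator_def qubit_behaviour_eq field_simps)

text \<open>Each summand \<open>p log (p / q)\<close> is at most 0 because the probability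
  \<open>p\<close> is part of the marginal \<open>q\<close>. This caps the key rate by Eve's
  uncertainty for every pair of inputs.\<close>

lemma cond_shannon_entropy_qubit_behaviour_nonneg: "0 \<le> cond_shannon_entropy (qubit_behaviour \<alpha> \<beta>) x y"
proof -
  let ?p = "\<lambda>a b. qubit_behaviour \<alpha> \<beta> a b x y"
  have nonneg: "0 \<le> ?p a b" if "a \<in> {0, 1}" "b \<in> {0, 1}" for a b
  proof -
    have "0 \<le> 1 + cos (\<alpha> x - \<beta> y)" "0 \<le> 1 - cos (\<alpha> x - \<beta> y)"
      using cos_ge_minus_one[of "\<alpha> x - \<beta> y"] cos_le_one[of "\<alpha> x - \<beta> y"] by linarith+
    then show ?thesis using that by (auto simp: qubit_behaviour_eq)
  qed
  have "?p a b * log 2 (?p a b / (\<Sum>a'\<in>{0, 1}. ?p a' b)) \<le> 0" if ab: "a \<in> {0, 1}" "b \<in> {0, 1}" for a b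
  proof (cases "?p a b = 0")
    case False
    have le: "?p a b \<le> (\<Sum>a'\<in>{0, 1}. ?p a' b)"
      using ab nonneg by (intro member_le_sum) auto
    have pos: "0 < ?p a b" using nonneg[OF ab] False by simp
    have "log 2 (?p a b / (\<Sum>a'\<in>{0, 1}. ?p a' b)) \<le> 0"
      using pos le by (subst log_le_zero_cancel_iff) (auto simp: divide_le_eq_1)
    with pos show ?thesis by (simp add: mult_nonneg_nonpos)
  qed simp
  then show ?thesis
    unfolding cond_shannon_entropy_def neg_0_le_iff_le by (intro sum_nonpos)
qed

text \<open>At equal angles a probability is either 1/2, equal to its marginal, so that the
  logarithm is that of 1, or 0, so that the factor in front removes the term.\<close>

lemma cond_shannon_entropy_qubit_behaviour_aligned:
  assumes "\<alpha> x = \<beta> y"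
  shows "cond_shannon_entropy (qubit_behaviour \<alpha> \<beta>) x y = 0"
  by (simp add: cond_shannon_entropy_def qubit_behaviour_eq assms)

section \<open>Eve's attainable entropies and the key rate\<close>

lemma eve_entropiesE:
  assumes "h \<in> eve_entropies \<theta> \<phi> \<omega> x"
  obtains IA IB E :: "nat set" and \<rho> M N \<Psi> where "quantum_strategy IA IB \<rho> M N"
    "has_target_correlators \<theta> \<phi> \<omega> (generated_behaviour IA IB \<rho> M N)"
    "purification (IA \<times> IB) E \<Psi> \<rho>"
    "has_cond_entropy {0, 1} E (cq_state IA IB E (\<lambda>a. M a x) \<Psi>) h"
  using assms unfolding eve_entropies_def mem_Collect_eq by (elim exE conjE) (rule that)

lemma eve_entropiesI:
  fixes IA IB E :: "nat set"
  assumes "quantum_strategy IA IB \<rho> M N"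
    "has_target_correlators \<theta> \<phi> \<omega> (generated_behaviour IA IB \<rho> M N)"
    "purification (IA \<times> IB) E \<Psi> \<rho>"
    "has_cond_entropy {0, 1} E (cq_state IA IB E (\<lambda>a. M a x) \<Psi>) h"
  shows "h \<in> eve_entropies \<theta> \<phi> \<omega> x"
  unfolding eve_entropies_def mem_Collect_eq by (intro exI conjI) (rule assms)+

lemma has_target_correlators_iff:
  "has_target_correlators (- t) (pi / 2) (pi / 2 - t) p \<longleftrightarrow>
     correlator p 0 0 = 1 \<and> correlator p 0 1 = cos t \<and> correlator p 1 0 = cos t \<and>
     correlator p 1 1 = 2 * (cos t)\<^sup>2 - 1"
proof -
  have "sin (pi / 2 - t) = cos t" "sin (- t + pi / 2) = cos t"
    by (simp_all add: sin_diff sin_add)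
  moreover have "sin (- t + (pi / 2 - t)) = 2 * (cos t)\<^sup>2 - 1"
    using sin_diff[of "pi / 2" "2 * t"] cos_double_cos[of t] by (simp add: algebra_simps)
  ultimately show ?thesis unfolding has_target_correlators_def by simp
qed

text \<open>The differences between Alice's and Bob's angles are \<open>0\<close>, \<open>t\<close>,
  \<open>t\<close> and \<open>2 t\<close>, and the correlators are their cosines.\<close>

abbreviation "optimal_behaviour t \<equiv> qubit_behaviour (\<lambda>x. if x = 0 then 0 else t) (\<lambda>y. if y = 0 then 0 else - t)"

lemma has_target_correlators_optimal:
  "has_target_correlators (- t) (pi / 2) (pi / 2 - t) (optimal_behaviour t)"
  unfolding has_target_correlators_iff correlator_qubit_behaviour
  using cos_double_cos[of t] by simp

lemma eve_entropies_eq: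
  assumes t: "0 < cos t" "cos t < 1" and x: "x \<in> {0, 1}"
  shows "eve_entropies (- t) (pi / 2) (pi / 2 - t) x = {1}"
proof -
  note target = has_target_correlators_iff[of t]
  have "h = 1" if eve: "h \<in> eve_entropies (- t) (pi / 2) (pi / 2 - t) x" for h
  proof -
    from eve obtain IA IB E :: "nat set" and \<rho> M N \<Psi>
      where strategy: "quantum_strategy IA IB \<rho> M N"
      and corr: "has_target_correlators (- t) (pi / 2) (pi / 2 - t) (generated_behaviour IA IB \<rho> M N)"
      and pur: "purification (IA \<times> IB) E \<Psi> \<rho>"
      and h: "has_cond_entropy {0, 1} E (cq_state IA IB E (\<lambda>a. M a x) \<Psi>) h"
      by (rule eve_entropiesE)
    interpret purified_strategy IA IB E \<rho> M N \<Psi>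
      by unfold_locales (rule strategy, rule pur)
    show ?thesis
      using cond_entropy_eq_1[OF _ _ _ _ t x h] corr unfolding target by blast
  qed
  \<comment> \<open>An infimum over the empty set would carry no information, so a strategy that
    attains the value is needed. The Bell state is pure and can be purified with a one-dimensional
    Eve.\<close>
  moreover have "1 \<in> eve_entropies (- t) (pi / 2) (pi / 2 - t) x"
  proof -
    let ?\<alpha> = "\<lambda>x :: nat. if x = 0 then 0 else t" and ?\<beta> = "\<lambda>y :: nat. if y = 0 then 0 else - t"
    define \<Psi> where "\<Psi> p = bell_state (fst p)" for p :: "(nat \<times> nat) \<times> nat"
    let ?M = "\<lambda>a x. qubit_effect (?\<alpha> x) a" and ?N = "\<lambda>b y. qubit_effect (?\<beta> y) b"
    have pur: "purification ({0, 1} \<times> {0, 1}) {0} \<Psi> (ketbra bell_state)"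
    proof -
      have "((\<lambda>_. 1) has_sum 1) {0 :: nat}" by (rule has_sum_finiteI) simp_all
      from has_sum_Times_mult_real[OF bell_state_norm this]
      show ?thesis by (simp add: purification_def \<Psi>_def trace_out_snd_def ketbra_def)
    qed
    interpret purified_strategy "{0, 1}" "{0, 1}" "{0}" "ketbra bell_state" ?M ?N \<Psi>
      by unfold_locales (rule quantum_strategy_qubits, rule pur)
    note target' = has_target_correlators_optimal[of t, unfolded qubit_behaviour_def]
    have "has_cond_entropy {0, 1} {0} (cq_state {0, 1} {0, 1} {0} (\<lambda>a. ?M a x) \<Psi>) 1"
      using has_cond_entropy_trivial_Eve[OF _ _ _ _ t x refl] target' unfolding target by blast
    then show ?thesis
      by (rule eve_entropiesI[OF quantum_strategy_qubits target' pur])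
  qed
  ultimately show ?thesis by blast
qed

theorem proposition4:
  fixes s :: real
  assumes "s \<in> {2<..5/2}"
  shows "\<exists>\<theta> \<phi> \<omega> p. quantum_behaviour p \<and> has_target_correlators \<theta> \<phi> \<omega> p \<and>
           key_rate \<theta> \<phi> \<omega> p = 1 \<and> CHSH p = s"
proof -
  \<comment> \<open>The smaller root of \<open>2 + 2 c - 2 c\<^sup>2 = s\<close>, which is
    equivalent to \<open>(2 c - 1)\<^sup>2 = 5 - 2 s\<close>. The bound \<open>s \<le> 5/2\<close>
    makes the root real, and \<open>s > 2\<close> makes it positive; the value \<open>5/2\<close> is
    the maximum of the parabola, at \<open>c = 1/2\<close>.\<close>
  define c where "c = (1 - sqrt (5 - 2 * s)) / 2"
  have "0 \<le> 5 - 2 * s" "5 - 2 * s < 1" using assms by auto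
  hence c: "0 < c" "c < 1" and s: "s = 2 + 2 * c - 2 * c\<^sup>2"
    by (auto simp: c_def power2_eq_square field_simps intro: add_pos_nonneg)
  define t where "t = arccos c"
  have cos_t: "cos t = c" using c by (simp add: t_def)
  let ?p = "optimal_behaviour t"
  have corr: "correlator ?p 0 0 = 1" "correlator ?p 0 1 = c" "correlator ?p 1 0 = c"
    "correlator ?p 1 1 = 2 * c\<^sup>2 - 1"
    using has_target_correlators_optimal[of t] unfolding has_target_correlators_iff cos_t by auto
  have "quantum_behaviour ?p"
    unfolding quantum_behaviour_def qubit_behaviour_def
    by (intro exI conjI, rule quantum_strategy_qubits) simp
  moreover have "key_rate (- t) (pi / 2) (pi / 2 - t) ?p = 1"
  proof -
    define H where "H = cond_shannon_entropy ?p"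
    have H: "0 \<le> H x y" "H 0 0 = 0" for x y
      unfolding H_def
      by (rule cond_shannon_entropy_qubit_behaviour_nonneg)
        (rule cond_shannon_entropy_qubit_behaviour_aligned, simp)
    have "Inf (eve_entropies (- t) (pi / 2) (pi / 2 - t) x) = 1" if "x \<in> {0, 1}" for x
      using eve_entropies_eq[OF _ _ that, of t] c by (simp add: cos_t)
    hence "key_rate (- t) (pi / 2) (pi / 2 - t) ?p = Max ((\<lambda>(x, y). 1 - H x y) ` ({0, 1} \<times> {0, 1}))"
      unfolding key_rate_def H_def[symmetric] by (intro arg_cong[where f = Max] image_cong) auto
    also have "\<dots> = 1"
    proof (rule Max_eqI)
      show "r \<le> 1" if "r \<in> (\<lambda>(x, y). 1 - H x y) ` ({0, 1} \<times> {0, 1})" for r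
        using that H(1) by auto
      show "1 \<in> (\<lambda>(x, y). 1 - H x y) ` ({0, 1} \<times> {0, 1})"
        by (rule image_eqI[of _ _ "(0, 0)"]) (simp_all add: H(2))
    qed simp
    finally show ?thesis .
  qed
  moreover have "CHSH ?p = s"
    unfolding CHSH_def corr s by simp
  ultimately show ?thesis
    using has_target_correlators_optimal[of t] by blast
qed

end
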